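(* Let $M$ be an $s\times n$ integer matrix and $\mathbf b\in\mathbb{R}^s$ such that $P_{M,\mathbf b}=\{\mathbf x\in\mathbb{R}_+^n:M\mathbf x=\mathbf b\}$ is an $(n-s)$-dimensional rational polytope. Then $\mathrm{vol}(P_{M,\mathbf b})=C_0\cdot T(\mathbf b|M)$, where $C_0=\gcd\{|\det Y|:Y\in\mathscr B(M)\}$.
   Context: $\mathscr B(M)$ is the set of $s\times s$ submatrices $Y$ of $M$ (formed by $s$ columns) with $\mathrm{span}(Y)=\mathbb{R}^s$. $T(\cdot|M)$ is the multivariate truncated power: the function on $\mathbb{R}^s$ with $\int T(x|M)\phi(x)dx=\int_{\mathbb{R}_+^n}\phi(Mu)du$ for all test functions $\phi$. A rational polytope is the convex hull of finitely many points with rational coordinates. For a $d$-dimensional polytope $P\subset\mathbb{R}^n$ with vertices spanning the affine space $\mathbb{R}_P$, choose an invertible affine map $T:\mathbb{R}_P\to\mathbb{R}^d$ with $T(\mathbb{R}_P\cap\mathbb{Z}^n)=\mathbb{Z}^d$; the relative volume $\mathrm{vol}(P)$ is the $d$-dimensional Lebesgue volume of $T(P)$. *)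

theory Defs
  imports "HOL-Analysis.Analysis"
begin

abbreviation real_matrix :: "int^'n^'s \<Rightarrow> real^'n^'s" where
  "real_matrix M \<equiv> map_matrix real_of_int M"

definition nonneg_orthant :: "(real^'n) set" where
  "nonneg_orthant = {u. \<forall>i. 0 \<le> u $ i}"

definition integer_points :: "(real^'n) set" where
  "integer_points = {x. \<forall>i. x $ i \<in> \<int>}"

(* The columns may be picked in any order; this affects det Y only by its sign. *)
definition square_bases :: "int^'n^'s \<Rightarrow> (int^'s^'s) set" where
  "square_bases M =
     {Y. (\<exists>f :: 's \<Rightarrow> 'n. inj f \<and> Y = (\<chi> i j. M $ i $ f j)) \<and>
         span (columns (real_matrix Y)) = UNIV}"

definition fiber_polytope :: "int^'n^'s \<Rightarrow> real^'s \<Rightarrow> (real^'n) set" where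
  "fiber_polytope M b = {x \<in> nonneg_orthant. real_matrix M *v x = b}"

definition rational_polytope :: "(real^'n) set \<Rightarrow> bool" where
  "rational_polytope P \<longleftrightarrow>
     (\<exists>V. finite V \<and> (\<forall>v\<in>V. \<forall>i. v $ i \<in> \<rat>) \<and> P = convex hull V)"

(* C-infinity functions: all iterated directional derivatives exist and are (Frechet)
   differentiable, hence continuous. *)
coinductive smooth :: "('a::real_normed_vector \<Rightarrow> real) \<Rightarrow> bool" where
  "(\<And>x. f differentiable (at x)) \<Longrightarrow>
   (\<And>v. smooth (\<lambda>x. frechet_derivative f (at x) v)) \<Longrightarrow> smooth f"

definition test_function :: "(real^'s \<Rightarrow> real) \<Rightarrow> bool" where
  "test_function \<phi> \<longleftrightarrow> smooth \<phi> \<and> compact (closure {x. \<phi> x \<noteq> 0})"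

(* The integral identity determines T only almost everywhere.  Pointwise values are fixed by
   the usual normalisation: T vanishes off the closed cone spanned by the columns of M and is
   continuous on that cone (as a function on the cone, boundary included).  For a square
   nonsingular M this gives 1/|det M| times the indicator of the closed cone. *)
definition is_truncated_power :: "int^'n^'s \<Rightarrow> (real^'s \<Rightarrow> real) \<Rightarrow> bool" where
  "is_truncated_power M T \<longleftrightarrow>
     (\<forall>\<phi>. test_function \<phi> \<longrightarrow>
        integrable lborel (\<lambda>x. T x * \<phi> x) \<and>
        set_integrable lborel nonneg_orthant (\<lambda>u. \<phi> (real_matrix M *v u)) \<and>
        (LINT x|lborel. T x * \<phi> x) =
          (LINT u:nonneg_orthant|lborel. \<phi> (real_matrix M *v u))) \<and>
     (\<forall>x. x \<notin> (*v) (real_matrix M) ` nonneg_orthant \<longrightarrow> T x = 0) \<and>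
     continuous_on ((*v) (real_matrix M) ` nonneg_orthant) T"

definition truncated_power :: "int^'n^'s \<Rightarrow> real^'s \<Rightarrow> real" where
  "truncated_power M = (THE T. is_truncated_power M T)"

definition polytope_dim :: "(real^'n) set \<Rightarrow> nat" where
  "polytope_dim P = nat (aff_dim P)"

(* R^d, with d depending on P, is the set of functions on {..<d} (extended by undefined); for
   d = 0 it is a single point, of volume 1.
   If the affine hull of P contains integer points, then p is one of them and the last condition
   says that Phi maps the integer points of the affine hull onto Z^d.  If it contains none (as
   for x + y = 1/2), no such map exists and volume is normalised by the translate p + Z^n of
   the integer lattice instead; the choice of p does not affect the volume. *)
definition lattice_chart :: "(real^'n) set \<Rightarrow> (real^'n \<Rightarrow> nat \<Rightarrow> real) \<Rightarrow> bool" where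
  "lattice_chart P \<Phi> \<longleftrightarrow>
     bij_betw \<Phi> (affine hull P) ({..<polytope_dim P} \<rightarrow>\<^sub>E UNIV) \<and>
     (\<forall>x\<in>affine hull P. \<forall>y\<in>affine hull P. \<forall>t. \<forall>k<polytope_dim P.
        \<Phi> ((1 - t) *\<^sub>R x + t *\<^sub>R y) k = (1 - t) * \<Phi> x k + t * \<Phi> y k) \<and>
     (\<exists>p\<in>affine hull P.
        (affine hull P \<inter> integer_points \<noteq> {} \<longrightarrow> p \<in> integer_points) \<and>
        \<Phi> ` {x \<in> affine hull P. x - p \<in> integer_points} = ({..<polytope_dim P} \<rightarrow>\<^sub>E \<int>))"

definition relative_volume :: "(real^'n) set \<Rightarrow> real" where
  "relative_volume P =
     measure (Pi\<^sub>M {..<polytope_dim P} (\<lambda>_. lborel)) ((SOME \<Phi>. lattice_chart P \<Phi>) ` P)"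

end

theory Submission
  imports Defs
begin

text \<open>Column operations over the integers bring \<open>M\<close> to the form \<open>M U = [H | 0]\<close> with \<open>U\<close>
  unimodular and \<open>H\<close> square and nonsingular. Expanding determinants of rectangular products in both
  directions shows that the greatest common divisor of the maximal minors of \<open>M\<close> is \<open>|det H|\<close>. In the
  coordinates \<open>u = U (y, w)\<close> the fiber over \<open>x\<close> is \<open>S x = {w. U (H\<^sup>-\<^sup>1 x, w) \<ge> 0}\<close>. Since \<open>U\<close> preserves
  Lebesgue measure and \<open>H\<close> scales it by \<open>|det H|\<close>, Fubini's theorem identifies the truncated power as
  \<open>vol (S x) / |det H|\<close>. This function is continuous on the cone, boundary included: the indicator of
  \<open>S x\<close> converges off the hyperplanes bounding \<open>S x\<close>, because the constraints that do not involve \<open>w\<close>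
  hold automatically on the cone. On the other hand \<open>w\<close> is a lattice chart of the fiber, so the
  relative volume is \<open>vol (S b)\<close>.\<close>

section \<open>Linear substitution\<close>

text \<open>The factor C_0 is the discrepancy between two normalisations of the same d-dimensional
  volume. Since \<open>U\<close> is unimodular, \<open>w\<close> gives lattice coordinates on the
  kernel of \<open>M\<close>, which is the normalisation of the relative volume. The truncated power
  is a density with respect to dx, and passing from y to x = H y costs |det H|.

  Two obstacles shape the argument. The integral identity determines a function only almost
  everywhere, while the claim concerns one point b, which may lie on the boundary of the cone (for M
  the identity and b = 0 it does). Hence both existence and uniqueness have to control values on the
  boundary. Moreover d is a number and not a type, so R^d appears as functions on {..<d} with a
  product measure, whereas determinants live on \<open>real^'n\<close>; statements are carried from
  one setting to the other by adjoining s further coordinates.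

  Finiteness of all integrals comes from the polytope being bounded: then no nonzero vector of the
  orthant lies in the kernel of \<open>M\<close>, so \<open>M\<close> is proper on the
  orthant.\<close>

lemma shear_axis:
  fixes m n :: "'n::finite" and a b :: "real^'n"
  assumes "m \<noteq> n"
  defines "h \<equiv> \<lambda>v::real^'n. \<chi> i. if i = m then v $ m + v $ n else v $ i"
  shows "linear h" and "det (matrix h) = 1"
    and "measure lebesgue (h ` cbox a b) = measure lebesgue (cbox a b)"
proof -
  show lin: "linear h"
    unfolding h_def by (rule linearI) (auto simp: algebra_simps vec_eq_iff)
  have "matrix h = (\<chi> k. if k = m then row m (mat 1) + 1 *s row n (mat 1) else row k (mat 1))"
    by (auto simp: matrix_def h_def vec_eq_iff axis_def row_def mat_def)
  then show "det (matrix h) = 1"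
    using det_row_operation[OF \<open>m \<noteq> n\<close>, of "mat 1 :: real^'n^'n" 1] by simp
  \<comment> \<open>Translating by \<open>v\<close> moves the lower end of the n-th side to 0, which
    meets the sign condition of \<open>measure_shear_interval\<close>.\<close>
  define v where "v = axis n (a $ n)"
  have shift: "cbox a b = (+) v ` cbox (a - v) (b - v)"
    by (simp flip: cbox_translation)
  have "h ` cbox a b = (+) (h v) ` h ` cbox (a - v) (b - v)"
    unfolding shift image_image by (simp add: linear_add[OF lin])
  moreover have "measure lebesgue (h ` cbox (a - v) (b - v)) = measure lebesgue (cbox (a - v) (b - v))"
  proof (cases "cbox (a - v) (b - v) = {}")
    case False
    then show ?thesis
      unfolding h_def by (rule measure_shear_interval[OF \<open>m \<noteq> n\<close>]) (simp add: v_def)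
  qed simp
  ultimately show "measure lebesgue (h ` cbox a b) = measure lebesgue (cbox a b)"
    by (metis measure_translation shift)
qed

text \<open>Lebesgue measure is determined by its values on boxes, so a map whose preimages of boxes
  have the right volume preserves the volume of every Borel set under preimage.\<close>

lemma emeasure_lborel_eq_vimageI:
  fixes h :: "'a::euclidean_space \<Rightarrow> 'a"
  assumes [measurable]: "h \<in> borel_measurable borel" and "S \<in> sets borel"
    and "\<And>l u. (\<And>b. b \<in> Basis \<Longrightarrow> l \<bullet> b \<le> u \<bullet> b) \<Longrightarrow>
      emeasure lborel (h -` box l u) = (\<Prod>b\<in>Basis. (u - l) \<bullet> b)"
  shows "emeasure lborel (h -` S) = emeasure lborel S"
proof -
  have "lborel = distr lborel borel h"
    by (rule lborel_eqI) (auto simp: emeasure_distr assms(3))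
  then show ?thesis
    using assms(2) emeasure_distr[of h lborel borel S] by auto
qed

text \<open>Both sides are multiplicative under composition, so elementary maps suffice. Preimages
  are used instead of images because they keep Borel sets Borel. The invariant \<open>P\<close> is
  vacuous for singular maps; a composite with nonzero determinant has two nonsingular factors, so
  nothing is lost in the induction.\<close>

lemma emeasure_lborel_linear_vimage:
  fixes f :: "real^'n \<Rightarrow> real^'n"
  assumes "linear f" "det (matrix f) \<noteq> 0" "S \<in> sets borel"
  shows "ennreal \<bar>det (matrix f)\<bar> * emeasure lborel (f -` S) = emeasure lborel S"
proof -
  define P where "P f \<longleftrightarrow> linear f \<and> (det (matrix f) \<noteq> 0 \<longrightarrow> (\<forall>S\<in>sets borel.
      ennreal \<bar>det (matrix f)\<bar> * emeasure lborel (f -` S) = emeasure lborel S))" for f :: "real^'n \<Rightarrow> real^'n"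
  have "P f"
  proof (rule induct_linear_elementary[OF \<open>linear f\<close>])
    fix f g assume fg: "linear f" "linear g" and P: "P f" "P g"
    have [measurable]: "f \<in> borel_measurable borel"
      using fg by (simp add: borel_measurable_continuous_onI linear_continuous_on linear_conv_bounded_linear)
    have det: "det (matrix (f \<circ> g)) = det (matrix f) * det (matrix g)"
      using fg by (simp add: matrix_compose det_mul)
    show "P (f \<circ> g)"
      unfolding P_def
    proof (intro conjI impI ballI)
      show "linear (f \<circ> g)" using fg linear_compose by blast
    next
      fix S assume nz: "det (matrix (f \<circ> g)) \<noteq> 0" and S: "S \<in> sets (borel :: (real^'n) measure)"
      have fS: "f -` S \<in> sets borel"
        using measurable_sets[OF \<open>f \<in> borel_measurable borel\<close> S] by simp
      have "ennreal \<bar>det (matrix (f \<circ> g))\<bar> * emeasure lborel ((f \<circ> g) -` S)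
        = ennreal \<bar>det (matrix f)\<bar> * (ennreal \<bar>det (matrix g)\<bar> * emeasure lborel (g -` (f -` S)))"
        by (simp add: det abs_mult ennreal_mult mult.assoc vimage_comp)
      also have "\<dots> = emeasure lborel S"
        using P nz S fS by (simp add: P_def det)
      finally show "ennreal \<bar>det (matrix (f \<circ> g))\<bar> * emeasure lborel ((f \<circ> g) -` S) = emeasure lborel S" .
    qed
  next
    fix f :: "real^'n \<Rightarrow> real^'n" and i
    assume f: "linear f" "\<And>x. f x $ i = 0"
    then have "\<not> inj f"
      by (metis (full_types) linear_injective_imp_surjective one_neq_zero surjE vec_component)
    then show "P f"
      using f det_nz_iff_inj P_def by blast
  next
    fix c :: "'n \<Rightarrow> real"
    let ?T = "\<lambda>x::real^'n. \<chi> i. c i * x $ i"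
    have lin: "linear ?T"
      by (rule linearI) (auto simp: algebra_simps vec_eq_iff)
    have [measurable]: "?T \<in> borel_measurable borel"
      using lin by (simp add: borel_measurable_continuous_onI linear_continuous_on linear_conv_bounded_linear)
    have det: "det (matrix ?T) = prod c UNIV"
      by (simp add: axis_def matrix_def det_diagonal)
    show "P ?T"
      unfolding P_def
    proof (intro conjI impI ballI)
      fix S :: "(real^'n) set" assume nz: "det (matrix ?T) \<noteq> 0" and S: "S \<in> sets borel"
      have inj: "inj (\<lambda>i::'n. axis i (1::real))"
        by (auto simp: inj_def axis_eq_axis)
      have B: "Basis = range (\<lambda>i::'n. axis i (1::real))"
        by (auto simp: Basis_vec_def)
      have c: "c i \<noteq> 0" for i using nz det by auto
      \<comment> \<open>The form of an affine coordinate scaling required by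
        \<open>lborel_affine_euclidean\<close>, with translation part 0.\<close>
      have T: "?T = (\<lambda>x. 0 + (\<Sum>j\<in>Basis. (c (axis_index j) * (x \<bullet> j)) *\<^sub>R j))"
      proof
        fix x :: "real^'n"
        have "(\<Sum>j\<in>Basis. (c (axis_index j) * (x \<bullet> j)) *\<^sub>R j) = (\<Sum>i\<in>UNIV. (c i * x $ i) *\<^sub>R axis i 1)"
          unfolding B by (subst sum.reindex[OF inj]) (simp add: inner_axis)
        then show "?T x = 0 + (\<Sum>j\<in>Basis. (c (axis_index j) * (x \<bullet> j)) *\<^sub>R j)"
          by (simp add: vec_eq_iff axis_def if_distrib cong: if_cong)
      qed
      have pr: "(\<Prod>j\<in>(Basis :: (real^'n) set). \<bar>c (axis_index j)\<bar>) = \<bar>prod c UNIV\<bar>"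
        unfolding B by (subst prod.reindex[OF inj]) (simp add: abs_prod)
      have "lborel = density (distr lborel borel ?T) (\<lambda>_. (\<Prod>j\<in>(Basis :: (real^'n) set). \<bar>c (axis_index j)\<bar>))"
        unfolding T by (rule lborel_affine_euclidean) (auto simp: c)
      then have "emeasure lborel S = emeasure (density (distr lborel borel ?T) (\<lambda>_. ennreal \<bar>prod c UNIV\<bar>)) S"
        unfolding pr by simp
      also have "\<dots> = ennreal \<bar>prod c UNIV\<bar> * emeasure lborel (?T -` S)"
        using S by (simp add: emeasure_density emeasure_distr nn_integral_cmult)
      finally show "ennreal \<bar>det (matrix ?T)\<bar> * emeasure lborel (?T -` S) = emeasure lborel S"
        using det by simp
    qed (fact lin)
  next
    fix m n :: 'n assume "m \<noteq> n"
    define t where "t = Transposition.transpose m n"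
    let ?h = "\<lambda>v::real^'n. \<chi> i. v $ t i"
    have tt [simp]: "t (t i) = i" for i by (simp add: t_def)
    have lin: "linear ?h"
      by (rule linearI) (simp_all add: vec_eq_iff)
    have "matrix ?h = transpose (\<chi> i j. mat 1 $ i $ t j)"
      by (auto simp: transpose_def mat_def matrix_def axis_def vec_eq_iff)
    then have 1: "\<bar>det (matrix ?h)\<bar> = 1"
      using \<open>m \<noteq> n\<close> by (simp add: t_def det_permute_columns permutes_swap_id sign_swap_id abs_mult)
    have "emeasure lborel (?h -` S) = emeasure lborel S" if S: "S \<in> sets borel" for S
    proof (rule emeasure_lborel_eq_vimageI[OF _ S])
      show "?h \<in> borel_measurable borel"
        using lin by (simp add: borel_measurable_continuous_onI linear_continuous_on linear_conv_bounded_linear)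
    next
      fix l u :: "real^'n" assume le: "\<And>b. b \<in> Basis \<Longrightarrow> l \<bullet> b \<le> u \<bullet> b"
      have inj: "inj (\<lambda>i::'n. axis i (1::real))"
        by (auto simp: inj_def axis_eq_axis)
      have B: "Basis = range (\<lambda>i::'n. axis i (1::real))"
        by (auto simp: Basis_vec_def)
      have le': "l $ i \<le> u $ i" for i
        using le[of "axis i 1"] by (simp add: B inner_axis)
      have "(\<forall>i. l $ i < x $ t i \<and> x $ t i < u $ i) \<longleftrightarrow> (\<forall>i. l $ t i < x $ i \<and> x $ i < u $ t i)"
        for x :: "real^'n"
        by (metis tt)
      then have eq: "?h -` box l u = box (?h l) (?h u)"
        by (auto simp: mem_box_cart)
      have t: "bij t" by (simp add: t_def)
      show "emeasure lborel (?h -` box l u) = (\<Prod>b\<in>Basis. (u - l) \<bullet> b)"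
        unfolding eq
        unfolding emeasure_lborel_box_eq B prod.reindex[OF inj]
        using le' prod.reindex_bij_betw[OF t, of "\<lambda>i. u $ i - l $ i"] by (auto simp: inner_axis)
    qed
    then show "P (\<lambda>x. \<chi> i. x $ Transposition.transpose m n i)"
      using lin 1 by (simp add: P_def t_def)
  next
    fix m n :: 'n assume "m \<noteq> n"
    let ?h = "\<lambda>x::real^'n. \<chi> i. if i = m then x $ m + x $ n else x $ i"
    have lin: "linear ?h" and det: "det (matrix ?h) = 1"
      and cb: "\<And>a b. measure lebesgue (?h ` cbox a b) = measure lebesgue (cbox a b)"
      using shear_axis[OF \<open>m \<noteq> n\<close>] by auto
    have cont: "continuous_on UNIV ?h"
      using lin by (simp add: linear_continuous_on linear_conv_bounded_linear)
    have bij: "bij ?h"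
      using lin det det_nz_iff_inj[OF lin] linear_injective_imp_surjective by (auto simp: bij_def)
    have "emeasure lborel (?h -` S) = emeasure lborel S" if S: "S \<in> sets borel" for S
    proof (rule emeasure_lborel_eq_vimageI[OF _ S])
      show "?h \<in> borel_measurable borel"
        using cont by (simp add: borel_measurable_continuous_onI)
    next
      fix l u :: "real^'n" assume le: "\<And>b. b \<in> Basis \<Longrightarrow> l \<bullet> b \<le> u \<bullet> b"
      have inv: "linear (inv ?h)"
        using bij lin by (simp add: linear_injective_imp_surjective bij_is_inj inj_linear_imp_inv_linear)
      have "bounded (?h -` box l u)"
        using bounded_linear_image[OF bounded_box[of l u], of "inv ?h"] inv bij
        by (simp add: linear_conv_bounded_linear bij_vimage_eq_inv_image)
      moreover have op: "open (?h -` box l u)"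
        using open_vimage[OF open_box cont] .
      ultimately have lm: "?h -` box l u \<in> lmeasurable"
        by (simp add: lmeasurable_open)
      \<comment> \<open>The scaling rule speaks of images, so it is applied to the preimage of the
        box, whose image is the box again.\<close>
      have "measure lebesgue (?h ` (?h -` box l u)) = 1 * measure lebesgue (?h -` box l u)"
        using measure_linear_sufficient[OF lin lm, of 1] cb by simp
      moreover have "?h ` (?h -` box l u) = box l u"
        using bij by (simp add: bij_is_surj surj_image_vimage_eq)
      ultimately have "measure lebesgue (?h -` box l u) = measure lebesgue (box l u)"
        by simp
      then have "emeasure lebesgue (?h -` box l u) = emeasure lebesgue (box l u)"
        using lm by (simp add: emeasure_eq_measure2)
      then have "emeasure lborel (?h -` box l u) = emeasure lborel (box l u)"
        using op by simp
      then show "emeasure lborel (?h -` box l u) = (\<Prod>b\<in>Basis. (u - l) \<bullet> b)"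
        using le by simp
    qed
    then show "P ?h"
      using lin det by (simp add: P_def)
  qed
  then show ?thesis
    using assms by (simp add: P_def)
qed

text \<open>An equation between measures transfers integrability and the value of integrals at
  once.\<close>

lemma lborel_eq_density_distr_matrix:
  fixes A :: "real^'n^'n"
  assumes "det A \<noteq> 0"
  shows "lborel = density (distr lborel borel ((*v) A)) (\<lambda>_. ennreal \<bar>det A\<bar>)"
proof (rule measure_eqI)
  have m [measurable]: "(*v) A \<in> borel_measurable borel"
    by (simp add: borel_measurable_continuous_onI matrix_vector_mult_linear_continuous_on)
  fix S :: "(real^'n) set" assume "S \<in> sets lborel"
  then show "emeasure lborel S = emeasure (density (distr lborel borel ((*v) A)) (\<lambda>_. ennreal \<bar>det A\<bar>)) S"
    using emeasure_lborel_linear_vimage[of "(*v) A" S] assms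
    by (simp add: emeasure_density emeasure_distr nn_integral_cmult matrix_of_matrix_vector_mul)
qed simp

section \<open>Integer column reduction and maximal minors\<close>

text \<open>Encoded by an integer inverse rather than by |det U| = 1, because the inverse itself
  supplies lattice coordinates later.\<close>

definition unimodular :: "int^'n^'n \<Rightarrow> bool" where
  "unimodular U \<longleftrightarrow> (\<exists>V. U ** V = mat 1 \<and> V ** U = mat 1)"

lemma unimodular_mult: "unimodular A \<Longrightarrow> unimodular B \<Longrightarrow> unimodular (A ** B)"
  unfolding unimodular_def
proof safe
  fix V W assume "A ** V = mat 1" "V ** A = mat 1" "B ** W = mat 1" "W ** B = mat 1"
  then have "A ** B ** (W ** V) = mat 1" "W ** V ** (A ** B) = mat 1"
    by (metis matrix_mul_assoc matrix_mul_rid)+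
  then show "\<exists>V. A ** B ** V = mat 1 \<and> V ** (A ** B) = mat 1" by blast
qed

lemma unimodular_mat_1 [simp]: "unimodular (mat 1)"
  unfolding unimodular_def by (intro exI[of _ "mat 1"]) simp

definition add_column :: "'n \<Rightarrow> 'n \<Rightarrow> int \<Rightarrow> int^'n^'n" where
  "add_column k l c = (\<chi> i j. (if i = j then 1 else 0) + (if j = k then if i = l then c else 0 else 0))"

lemma mult_add_column:
  "(A ** add_column k l c) $ i $ j = A $ i $ j + (if j = k then c * A $ i $ l else 0)"
proof -
  have "A $ i $ m * add_column k l c $ m $ j =
      (if m = j then A $ i $ m else 0) + (if m = l then if j = k then c * A $ i $ m else 0 else 0)" for m
    by (simp add: add_column_def distrib_left)
  then show ?thesis
    by (simp add: matrix_matrix_mult_def sum.distrib)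
qed

lemma unimodular_add_column: "k \<noteq> l \<Longrightarrow> unimodular (add_column k l c)"
  unfolding unimodular_def
  by (intro exI[of _ "add_column k l (- c)"])
     (auto simp: vec_eq_iff mult_add_column, auto simp: add_column_def mat_def)

text \<open>The Euclidean algorithm on row \<open>r\<close>, using only columns outside
  \<open>K\<close>. The rows in \<open>R\<close> vanish on those columns, so operations among them
  leave these zeros intact. The sum of |A r j| over j outside \<open>K\<close> decreases until at
  most one such entry is nonzero, and its column is the new pivot \<open>k\<close>.\<close>

lemma reduce_row:
  fixes A :: "int^'n^'s"
  assumes "\<And>i j. i \<in> R \<Longrightarrow> j \<notin> K \<Longrightarrow> A $ i $ j = 0"
  shows "\<exists>U k. unimodular U \<and> (\<forall>i\<in>R. \<forall>j. j \<notin> K \<longrightarrow> (A ** U) $ i $ j = 0) \<and>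
    (\<forall>j. j \<notin> insert k K \<longrightarrow> (A ** U) $ r $ j = 0)"
  using assms
proof (induction "nat (\<Sum>j\<in>-K. \<bar>A $ r $ j\<bar>)" arbitrary: A rule: less_induct)
  case less
  show ?case
  proof (cases "\<exists>k. \<forall>j. j \<notin> insert k K \<longrightarrow> A $ r $ j = 0")
    case True
    then obtain k where "\<forall>j. j \<notin> insert k K \<longrightarrow> A $ r $ j = 0" by blast
    then show ?thesis
      using less.prems by (intro exI[of _ "mat 1"] exI[of _ k]) (simp del: insert_iff)
  next
    case False
    then obtain k where k: "k \<notin> K" "A $ r $ k \<noteq> 0" by blast
    with False obtain l where l: "l \<notin> insert k K" "A $ r $ l \<noteq> 0" by blast
    have red: ?thesis if kl: "k \<notin> K" "l \<notin> K" "k \<noteq> l" "A $ r $ l \<noteq> 0" "\<bar>A $ r $ l\<bar> \<le> \<bar>A $ r $ k\<bar>" for k l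
    proof -
      \<comment> \<open>With this sign the new entry has absolute value |A r k| - |A r l|, which is
        smaller than |A r k| since A r l is nonzero.\<close>
      define c where "c = - sgn (A $ r $ k) * sgn (A $ r $ l)"
      define B where "B = A ** add_column k l c"
      have B: "B $ i $ j = A $ i $ j + (if j = k then c * A $ i $ l else 0)" for i j
        by (simp add: B_def mult_add_column)
      have "\<bar>B $ r $ k\<bar> < \<bar>A $ r $ k\<bar>"
        using kl by (auto simp: B c_def sgn_if split: if_splits)
      then have "(\<Sum>j\<in>-K. \<bar>B $ r $ j\<bar>) < (\<Sum>j\<in>-K. \<bar>A $ r $ j\<bar>)"
        using kl by (intro sum_strict_mono_ex1) (auto simp: B)
      then have lt: "nat (\<Sum>j\<in>-K. \<bar>B $ r $ j\<bar>) < nat (\<Sum>j\<in>-K. \<bar>A $ r $ j\<bar>)"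
        by (subst nat_less_eq_zless) (auto intro: sum_nonneg)
      have z: "B $ i $ j = 0" if "i \<in> R" "j \<notin> K" for i j
        using less.prems that kl by (simp add: B)
      obtain U m where U: "unimodular U" "\<forall>i\<in>R. \<forall>j. j \<notin> K \<longrightarrow> (B ** U) $ i $ j = 0"
        "\<forall>j. j \<notin> insert m K \<longrightarrow> (B ** U) $ r $ j = 0"
        using less.hyps[OF lt z] by blast
      have eq: "A ** (add_column k l c ** U) = B ** U"
        by (simp add: B_def matrix_mul_assoc)
      show ?thesis
      proof (intro exI conjI)
        show "unimodular (add_column k l c ** U)"
          using U(1) kl by (simp add: unimodular_mult unimodular_add_column)
      qed (use U(2,3) in \<open>simp_all only: eq\<close>)
    qed
    show ?thesis
    proof (cases "\<bar>A $ r $ l\<bar> \<le> \<bar>A $ r $ k\<bar>")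
      case True
      then show ?thesis by (intro red[of k l]) (use k l in auto)
    next
      case False
      then show ?thesis by (intro red[of l k]) (use k l in auto)
    qed
  qed
qed

text \<open>Each row contributes at most one pivot column, whence the bound on
  \<open>card K\<close>.\<close>

lemma column_reduction:
  fixes M :: "int^'n^'s"
  shows "\<exists>U K. unimodular U \<and> card K \<le> CARD('s) \<and> (\<forall>i j. j \<notin> K \<longrightarrow> (M ** U) $ i $ j = 0)"
proof -
  have "\<exists>U K. unimodular U \<and> card K \<le> card R \<and> (\<forall>i\<in>R. \<forall>j. j \<notin> K \<longrightarrow> (M ** U) $ i $ j = 0)"
    for R :: "'s set"
    using finite[of R]
  proof (induction R)
    case empty
    show ?case by (intro exI[of _ "mat 1"] exI[of _ "{}"]) simp
  next
    case (insert r R)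
    then obtain U K where U: "unimodular U" "card K \<le> card R"
      "\<And>i j. i \<in> R \<Longrightarrow> j \<notin> K \<Longrightarrow> (M ** U) $ i $ j = 0" by blast
    obtain W k where W: "unimodular W" "\<forall>i\<in>R. \<forall>j. j \<notin> K \<longrightarrow> (M ** U ** W) $ i $ j = 0"
      "\<forall>j. j \<notin> insert k K \<longrightarrow> (M ** U ** W) $ r $ j = 0"
      using reduce_row[of R K "M ** U" r, OF U(3)] by blast
    have "card (insert k K) \<le> card (insert r R)"
      using U(2) insert by (simp add: card_insert_if)
    moreover have "\<forall>i\<in>insert r R. \<forall>j. j \<notin> insert k K \<longrightarrow> (M ** (U ** W)) $ i $ j = 0"
      unfolding matrix_mul_assoc using W(2,3) by auto
    ultimately show ?case
      using unimodular_mult[OF U(1) W(1)] by blast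
  qed
  from this[of UNIV] show ?thesis by auto
qed

text \<open>The Cauchy-Binet formula before grouping by images: the sum runs over all maps
  \<open>g\<close>, injective or not. This form is enough for divisibility and avoids choosing an
  order on the columns.\<close>

lemma det_mult_rectangular:
  fixes A :: "'a::comm_ring_1^'n^'s" and B :: "'a^'s^'n"
  shows "det (A ** B) = (\<Sum>g\<in>UNIV. (\<Prod>i\<in>UNIV. B $ g i $ i) * det (\<chi> i j. A $ i $ g j))"
proof -
  have "det (A ** B) = det (transpose (A ** B))"
    by (simp add: det_transpose)
  also have "\<dots> = (\<Sum>p | p permutes UNIV. of_int (sign p) * (\<Prod>i\<in>UNIV. \<Sum>k\<in>UNIV. B $ k $ i * A $ p i $ k))"
    by (simp add: det_def transpose_def matrix_matrix_mult_def mult.commute)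
  also have "\<dots> = (\<Sum>p | p permutes UNIV. of_int (sign p) * (\<Sum>g\<in>UNIV. \<Prod>i\<in>UNIV. B $ g i $ i * A $ p i $ g i))"
    by (subst prod_sum_PiE) (auto simp: PiE_UNIV_domain)
  also have "\<dots> = (\<Sum>g\<in>UNIV. (\<Prod>i\<in>UNIV. B $ g i $ i) *
      (\<Sum>p | p permutes UNIV. of_int (sign p) * (\<Prod>i\<in>UNIV. A $ p i $ g i)))"
    by (simp add: sum_distrib_left prod.distrib mult.left_commute) (rule sum.swap)
  also have "\<dots> = (\<Sum>g\<in>UNIV. (\<Prod>i\<in>UNIV. B $ g i $ i) * det (transpose (\<chi> i j. A $ i $ g j)))"
    by (simp add: det_def transpose_def)
  finally show ?thesis
    by (simp add: det_transpose)
qed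

lemma det_real_matrix: "det (real_matrix Y) = real_of_int (det Y)"
  by (simp add: det_def map_matrix_def)

lemma real_matrix_mult: "real_matrix (A ** B) = real_matrix A ** real_matrix B"
  by (simp add: vec_eq_iff map_matrix_def matrix_matrix_mult_def)

lemma real_matrix_mat_1 [simp]: "real_matrix (mat 1) = mat 1"
  by (simp add: vec_eq_iff map_matrix_def mat_def)

lemma square_bases_eq:
  "square_bases M = {Y. (\<exists>f. inj f \<and> Y = (\<chi> i j. M $ i $ f j)) \<and> det Y \<noteq> 0}"
proof -
  have "span (columns (real_matrix Y)) = UNIV \<longleftrightarrow> det Y \<noteq> 0" for Y :: "int^'s^'s"
  proof -
    have "span (columns (real_matrix Y)) = UNIV \<longleftrightarrow> (\<exists>B. real_matrix Y ** B = mat 1)"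
      by (simp add: matrix_right_invertible_span_columns span_vec_eq)
    also have "\<dots> \<longleftrightarrow> invertible (real_matrix Y)"
      by (metis invertible_def matrix_left_right_inverse)
    finally show ?thesis
      by (simp add: invertible_det_nz det_real_matrix)
  qed
  then show ?thesis by (auto simp: square_bases_def)
qed

text \<open>\<open>H\<close> is \<open>M\<close> times the selected columns of \<open>U\<close>, so
  det H is an integer combination of maximal minors. Conversely \<open>M\<close> is \<open>H\<close>
  times the selected rows of \<open>V\<close>, so det H divides every maximal minor.\<close>

lemma Gcd_square_bases:
  fixes M :: "int^'n^'s"
  assumes UV: "U ** V = mat 1" and "inj f"
    and zero: "\<And>i j. j \<notin> range f \<Longrightarrow> (M ** U) $ i $ j = 0"
    and H: "H = (\<chi> i j. (M ** U) $ i $ f j)"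
  shows "(GCD Y\<in>square_bases M. \<bar>det Y\<bar>) = \<bar>det H\<bar>"
proof (rule zdvd_antisym_nonneg)
  let ?C = "GCD Y\<in>square_bases M. \<bar>det Y\<bar>"
  \<comment> \<open>Minors outside the set of bases are zero, either because a column is repeated or
    by singularity, so the gcd divides all of them.\<close>
  have "?C dvd det (\<chi> i j. M $ i $ g j)" for g :: "'s \<Rightarrow> 'n"
  proof (cases "inj g \<and> det (\<chi> i j. M $ i $ g j) \<noteq> 0")
    case True
    then have "?C dvd \<bar>det (\<chi> i j. M $ i $ g j)\<bar>"
      by (intro Gcd_dvd) (auto simp: square_bases_eq)
    then show ?thesis by simp
  next
    case False
    have "det (\<chi> i j. M $ i $ g j) = 0" if "\<not> inj g"
    proof -
      obtain k l where "k \<noteq> l" "g k = g l"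
        using \<open>\<not> inj g\<close> by (auto simp: inj_def)
      then show ?thesis
        by (intro det_identical_columns[of k l]) (auto simp: column_def)
    qed
    with False show ?thesis by auto
  qed
  moreover have "H = M ** (\<chi> i j. U $ i $ f j)"
    by (simp add: H vec_eq_iff matrix_matrix_mult_def)
  ultimately have "?C dvd det H"
    by (simp add: det_mult_rectangular dvd_sum)
  then show "?C dvd \<bar>det H\<bar>" by simp
next
  have M: "M $ i $ j = (\<Sum>t\<in>UNIV. H $ i $ t * V $ f t $ j)" for i j
  proof -
    have "M = M ** U ** V"
      by (metis UV matrix_mul_assoc matrix_mul_rid)
    then have "M $ i $ j = (\<Sum>k\<in>UNIV. (M ** U) $ i $ k * V $ k $ j)"
      by (metis (no_types, lifting) matrix_matrix_mult_def sum.cong vec_lambda_beta)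
    also have "\<dots> = (\<Sum>k\<in>range f. (M ** U) $ i $ k * V $ k $ j)"
      by (rule sum.mono_neutral_right) (auto simp: zero)
    finally show ?thesis
      by (simp add: sum.reindex[OF \<open>inj f\<close>] H)
  qed
  show "\<bar>det H\<bar> dvd (GCD Y\<in>square_bases M. \<bar>det Y\<bar>)"
  proof (rule Gcd_greatest)
    fix x assume "x \<in> (\<lambda>Y. \<bar>det Y\<bar>) ` square_bases M"
    then obtain g :: "'s \<Rightarrow> 'n" where g: "x = \<bar>det (\<chi> i j. M $ i $ g j)\<bar>"
      by (auto simp: square_bases_eq)
    have "(\<chi> i j. M $ i $ g j) = H ** (\<chi> t j. V $ f t $ g j)"
      by (simp add: vec_eq_iff M matrix_matrix_mult_def)
    then show "\<bar>det H\<bar> dvd x"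
      by (simp add: g det_mul)
  qed
qed auto

text \<open>The pivot set may have fewer than s elements; it is enlarged to exactly s columns, which
  is possible because s is at most n. Then \<open>H\<close> inherits surjectivity from
  \<open>M\<close> and is therefore nonsingular.\<close>

lemma full_rank_column_reduction:
  fixes M :: "int^'n^'s"
  assumes "rank (real_matrix M) = CARD('s)"
  obtains U V :: "int^'n^'n" and f :: "'s \<Rightarrow> 'n" where "U ** V = mat 1" "V ** U = mat 1" "inj f"
    "\<And>i j. j \<notin> range f \<Longrightarrow> (M ** U) $ i $ j = 0" "det (\<chi> i j. (M ** U) $ i $ f j) \<noteq> 0"
proof -
  obtain U K where U: "unimodular U" and K: "card K \<le> CARD('s)"
    "\<And>i j. j \<notin> K \<Longrightarrow> (M ** U) $ i $ j = 0"
    using column_reduction[of M] by blast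
  then obtain V where V: "U ** V = mat 1" "V ** U = mat 1"
    by (auto simp: unimodular_def)
  have "CARD('s) \<le> CARD('n)"
    using rank_bound[of "real_matrix M"] assms by simp
  then obtain K' where K': "K \<subseteq> K'" "card K' = CARD('s)"
    using exists_subset_between[of K "CARD('s)" UNIV] K(1) by auto
  then obtain f where f: "bij_betw f (UNIV :: 's set) K'"
    using finite_same_card_bij[of "UNIV :: 's set" K'] by auto
  define H where "H = (\<chi> i j. (M ** U) $ i $ f j)"
  have zero: "(M ** U) $ i $ j = 0" if "j \<notin> range f" for i j
    using that K(2) K' f by (auto simp: bij_betw_def)
  have inj: "inj f" using f by (auto simp: bij_betw_def)
  have "surj ((*v) (real_matrix H))"
    unfolding surj_def
  proof
    fix y :: "real^'s"
    have "surj ((*v) (real_matrix M))"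
      using assms full_rank_surjective by blast
    then obtain x where x: "y = real_matrix M *v x" by (metis surjD)
    define v where "v = real_matrix V *v x"
    have "y = real_matrix (M ** U) *v v"
      unfolding v_def x matrix_vector_mul_assoc
      by (simp add: V flip: real_matrix_mult matrix_mul_assoc)
    moreover have "real_matrix (M ** U) *v v = real_matrix H *v (\<chi> t. v $ f t)"
    proof -
      have "(\<Sum>j\<in>UNIV. real_of_int ((M ** U) $ i $ j) * v $ j) = (\<Sum>j\<in>range f. real_of_int ((M ** U) $ i $ j) * v $ j)" for i
        by (rule sum.mono_neutral_right) (auto simp: zero)
      then show ?thesis
        by (simp add: vec_eq_iff matrix_vector_mult_def map_matrix_def H_def sum.reindex[OF inj])
    qed
    ultimately show "\<exists>z. y = real_matrix H *v z" by metis
  qed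
  then have "det (real_matrix H) \<noteq> 0"
    by (metis det_nz_iff_inj linear_surjective_imp_injective matrix_of_matrix_vector_mul matrix_vector_mul_linear)
  then have "det H \<noteq> 0"
    by (simp add: det_real_matrix)
  then show thesis
    by (intro that[of U V f]) (simp_all add: H_def V inj zero)
qed

section \<open>Splitting Lebesgue measure\<close>

abbreviation lborel_fun :: "nat \<Rightarrow> (nat \<Rightarrow> real) measure" where
  "lborel_fun d \<equiv> Pi\<^sub>M {..<d} (\<lambda>_. lborel)"

interpretation lborel_fun: product_sigma_finite "\<lambda>_::nat. lborel :: real measure" ..

interpretation lborel_fun_sigma: sigma_finite_measure "lborel_fun d" for d
  by (rule lborel_fun.sigma_finite) simp

text \<open>The coordinates of R^n are divided into s of them, indexed by \<open>f\<close>, and d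
  others, enumerated by \<open>e\<close>. The second block is indexed by numbers because the charts
  in the definition of relative volume take values in functions on {..<d}.\<close>

locale coordinate_split =
  fixes f :: "'s::finite \<Rightarrow> 'n::finite" and d :: nat and e :: "nat \<Rightarrow> 'n"
  assumes inj_f: "inj f" and bij_e: "bij_betw e {..<d} (- range f)"
begin

definition join :: "real^'s \<Rightarrow> (nat \<Rightarrow> real) \<Rightarrow> real^'n" where
  "join y w = (\<chi> i. if i \<in> range f then y $ inv f i else w (inv_into {..<d} e i))"

text \<open>The restriction makes the value \<open>undefined\<close> from d on, so that it is a
  point of the product space; \<open>tail\<close> inverts \<open>join\<close> only on such
  extensional functions.\<close>

definition tail :: "real^'n \<Rightarrow> nat \<Rightarrow> real" where
  "tail v = (\<lambda>k\<in>{..<d}. v $ e k)"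

lemma e_notin: "k < d \<Longrightarrow> e k \<notin> range f"
  using bij_e by (auto simp: bij_betw_def)

lemma join_f [simp]: "join y w $ f t = y $ t"
  by (simp add: join_def inj_f)

lemma join_e [simp]: "k < d \<Longrightarrow> join y w $ e k = w k"
  using bij_e e_notin[of k] by (simp add: join_def bij_betw_inv_into_left)

lemma coordinate_cases:
  obtains t where "i = f t" | k where "k < d" "i = e k"
proof (cases "i \<in> range f")
  case False
  then have "i \<in> e ` {..<d}"
    using bij_e by (simp add: bij_betw_def)
  with that(2) show thesis by auto
qed (use that(1) in blast)

lemma vec_eq_split: "u = v \<longleftrightarrow> (\<forall>t. u $ f t = v $ f t) \<and> (\<forall>k<d. u $ e k = v $ e k)"
  by (metis coordinate_cases vec_eq_iff)

lemma join_tail [simp]: "join (\<chi> t. v $ f t) (tail v) = v"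
  by (simp add: vec_eq_split tail_def)

lemma tail_in_space [simp]: "tail v \<in> space (lborel_fun d)"
  by (simp add: tail_def space_PiM)

lemma tail_join: "w \<in> space (lborel_fun d) \<Longrightarrow> tail (join y w) = w"
  by (auto simp: tail_def space_PiM PiE_def extensional_def)

lemma prod_split: "(\<Prod>i\<in>UNIV. g i) = (\<Prod>t\<in>UNIV. g (f t)) * (\<Prod>k<d. g (e k))"
  for g :: "'n \<Rightarrow> 'a::comm_monoid_mult"
proof -
  have "(\<Prod>i\<in>UNIV. g i) = (\<Prod>i\<in>range f. g i) * (\<Prod>i\<in>-range f. g i)"
    by (subst prod.union_disjoint[symmetric]) auto
  then show ?thesis
    by (simp add: prod.reindex[OF inj_f] prod.reindex_bij_betw[OF bij_e])
qed

lemma measurable_join [measurable]: "(\<lambda>(y, w). join y w) \<in> lborel \<Otimes>\<^sub>M lborel_fun d \<rightarrow>\<^sub>M borel"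
proof (rule borel_measurable_euclidean_space[THEN iffD2], intro ballI)
  fix b :: "real^'n" assume "b \<in> Basis"
  then obtain i where b: "b = axis i 1"
    by (auto simp: Basis_vec_def)
  show "(\<lambda>x. (case x of (y, w) \<Rightarrow> join y w) \<bullet> b) \<in> borel_measurable (lborel \<Otimes>\<^sub>M lborel_fun d)"
    by (cases i rule: coordinate_cases)
       (auto simp: b inner_axis case_prod_unfold intro!: measurable_compose[OF measurable_snd]
         measurable_compose[OF measurable_fst])
qed

text \<open>Both measures give a box the product of its side lengths. Fubini's theorem for the two
  coordinate blocks is used through this identity.\<close>

lemma lborel_join: "distr (lborel \<Otimes>\<^sub>M lborel_fun d) borel (\<lambda>(y, w). join y w) = lborel"
proof (rule lborel_eqI[symmetric])
  fix l u :: "real^'n" assume le: "\<And>b. b \<in> Basis \<Longrightarrow> l \<bullet> b \<le> u \<bullet> b"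
  have inj: "inj (\<lambda>i::'n. axis i (1::real))" "inj (\<lambda>i::'s. axis i (1::real))"
    by (auto simp: inj_def axis_eq_axis)
  have B: "(Basis :: (real^'n) set) = range (\<lambda>i. axis i 1)" "(Basis :: (real^'s) set) = range (\<lambda>i. axis i 1)"
    by (auto simp: Basis_vec_def)
  have le': "l $ i \<le> u $ i" for i
    using le[of "axis i 1"] by (simp add: B inner_axis)
  let ?Y = "box (\<chi> t. l $ f t) (\<chi> t. u $ f t)" and ?W = "\<Pi>\<^sub>E k\<in>{..<d}. {l $ e k <..< u $ e k}"
  have "(\<lambda>(y, w). join y w) -` box l u \<inter> space (lborel \<Otimes>\<^sub>M lborel_fun d) = ?Y \<times> ?W"
  proof -
    have "join y w \<in> box l u \<longleftrightarrow> y \<in> ?Y \<and> (\<forall>k<d. w k \<in> {l $ e k <..< u $ e k})" for y w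
      by (auto simp: mem_box_cart) (metis coordinate_cases join_e join_f)+
    then show ?thesis
      by (auto simp: space_pair_measure space_PiM PiE_iff)
  qed
  then have "emeasure (distr (lborel \<Otimes>\<^sub>M lborel_fun d) borel (\<lambda>(y, w). join y w)) (box l u)
      = emeasure (lborel \<Otimes>\<^sub>M lborel_fun d) (?Y \<times> ?W)"
    by (simp add: emeasure_distr)
  also have "\<dots> = emeasure lborel ?Y * emeasure (lborel_fun d) ?W"
    by (rule lborel_fun_sigma.emeasure_pair_measure_Times) (auto intro!: sets_PiM_I_finite)
  also have "emeasure lborel ?Y = (\<Prod>t\<in>UNIV. u $ f t - l $ f t)"
    unfolding emeasure_lborel_box_eq B prod.reindex[OF inj(2)] using le' by (simp add: inner_axis)
  also have "emeasure (lborel_fun d) ?W = (\<Prod>k<d. ennreal (u $ e k - l $ e k))"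
    by (subst lborel_fun.emeasure_PiM) (auto simp: le')
  also have "ennreal (\<Prod>t\<in>UNIV. u $ f t - l $ f t) * \<dots> = (\<Prod>i\<in>UNIV. u $ i - l $ i)"
    by (simp add: prod_split le' prod_nonneg prod_ennreal ennreal_mult)
  finally show "emeasure (distr (lborel \<Otimes>\<^sub>M lborel_fun d) borel (\<lambda>(y, w). join y w)) (box l u)
      = (\<Prod>b\<in>Basis. (u - l) \<bullet> b)"
    unfolding B prod.reindex[OF inj(1)] by (simp add: inner_axis)
qed simp

lemma join_add: "join (y + y') (\<lambda>k. w k + w' k) = join y w + join y' w'"
  by (simp add: vec_eq_split)

lemma join_scaleR: "join (c *\<^sub>R y) (\<lambda>k. c * w k) = c *\<^sub>R join y w"
  by (simp add: vec_eq_split)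

lemma inner_join: "a \<bullet> join y w = (\<Sum>t\<in>UNIV. a $ f t * y $ t) + (\<Sum>k<d. a $ e k * w k)"
proof -
  have "a \<bullet> join y w = (\<Sum>i\<in>range f. a $ i * join y w $ i) + (\<Sum>i\<in>-range f. a $ i * join y w $ i)"
    by (subst sum.union_disjoint[symmetric]) (auto simp: inner_vec_def)
  also have "(\<Sum>i\<in>-range f. a $ i * join y w $ i) = (\<Sum>k<d. a $ e k * join y w $ e k)"
    by (rule sum.reindex_bij_betw[OF bij_e, symmetric])
  finally show ?thesis
    by (simp add: sum.reindex[OF inj_f])
qed

text \<open>Deleting the \<open>f\<close>-coordinates of \<open>a\<close> gives a normal vector
  \<open>a'\<close> that is still nonzero. Its hyperplane pulls back to R^s times the set in
  question; this product is null and R^s has positive measure, so the other factor is null.\<close>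

lemma null_sets_join_hyperplane:
  fixes a :: "real^'n"
  assumes "k < d" "a $ e k \<noteq> 0"
  shows "{w \<in> space (lborel_fun d). a \<bullet> join y w = c} \<in> null_sets (lborel_fun d)" (is "?N \<in> _")
proof -
  define a' where "a' = join 0 (tail a)"
  have a': "a' \<noteq> 0"
    using assms by (auto simp: a'_def vec_eq_split tail_def)
  have eq: "a \<bullet> join y w = c \<longleftrightarrow> a' \<bullet> join z w = c - (\<Sum>t\<in>UNIV. a $ f t * y $ t)" for z w
    by (auto simp: inner_join a'_def tail_def)
  let ?P = "{v. a' \<bullet> v = c - (\<Sum>t\<in>UNIV. a $ f t * y $ t)}"
  have "closed ?P"
    by (rule closed_hyperplane)
  then have P: "?P \<in> sets borel" by simp
  have "?P \<in> null_sets lebesgue"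
    using negligible_hyperplane[of a'] a' negligible_iff_null_sets by blast
  then have "emeasure lborel ?P = 0"
    using P by (simp add: null_sets_def)
  then have "emeasure (distr (lborel \<Otimes>\<^sub>M lborel_fun d) borel (\<lambda>(y, w). join y w)) ?P = 0"
    by (simp only: lborel_join)
  moreover have "(\<lambda>(y, w). join y w) -` ?P \<inter> space (lborel \<Otimes>\<^sub>M lborel_fun d) = (UNIV :: (real^'s) set) \<times> ?N"
    by (simp add: set_eq_iff space_pair_measure conj_commute flip: eq)
  ultimately have 0: "emeasure (lborel \<Otimes>\<^sub>M lborel_fun d) ((UNIV :: (real^'s) set) \<times> ?N) = 0"
    using P by (simp add: emeasure_distr)
  have "(\<lambda>w. join y w) \<in> borel_measurable (lborel_fun d)"
    using measurable_Pair2[OF measurable_join, of y] by simp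
  then have N: "?N \<in> sets (lborel_fun d)"
    by measurable
  have "emeasure lborel (UNIV :: (real^'s) set) * emeasure (lborel_fun d) ?N = 0"
    using 0 lborel_fun_sigma.emeasure_pair_measure_Times[OF _ N, of "UNIV :: (real^'s) set" lborel] by simp
  then show ?thesis
    using N by (auto simp: null_sets_def)
qed

end

section \<open>Smooth bump functions\<close>

text \<open>The powers of t in the denominator make the family closed under differentiation: every
  derivative of exp(-1/t) is a combination of its members, all of which extend by 0 across t =
  0.\<close>

definition flat :: "nat \<Rightarrow> real \<Rightarrow> real" where
  "flat k t = (if t \<le> 0 then 0 else exp (- 1 / t) / t ^ k)"

lemma flat_pos_iff: "0 < flat k t \<longleftrightarrow> 0 < t"
  by (simp add: flat_def)

lemma flat_tendsto_0: "(flat k \<longlongrightarrow> 0) (at 0)"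
proof -
  have "((\<lambda>t. inverse t ^ k / exp (inverse t)) \<longlongrightarrow> (0::real)) (at_right 0)"
    using tendsto_power_div_exp_0 filterlim_inverse_at_top_right by (rule filterlim_compose)
  then have "(flat k \<longlongrightarrow> 0) (at_right 0)"
    by (rule Lim_transform_eventually)
       (auto simp: eventually_at_right_field flat_def field_simps exp_minus intro!: exI[of _ 1])
  moreover have "(flat k \<longlongrightarrow> 0) (at_left 0)"
    by (rule Lim_transform_eventually[OF tendsto_const])
       (auto simp: eventually_at_left_field flat_def intro!: exI[of _ "-1"])
  ultimately show ?thesis
    by (simp add: filterlim_at_split)
qed

lemma flat_has_derivative:
  "(flat k has_real_derivative flat (k + 2) t - k * flat (k + 1) t) (at t)"
proof (cases t "0 :: real" rule: linorder_cases)
  case less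
  then have "\<forall>\<^sub>F s in nhds t. flat k s = 0"
    by (intro eventually_mono[OF eventually_nhds_in_open[of "{..<0}" t]]) (auto simp: flat_def)
  then have "(flat k has_real_derivative 0) (at t) \<longleftrightarrow> ((\<lambda>_. 0) has_real_derivative 0) (at t)"
    by (intro DERIV_cong_ev) auto
  then show ?thesis
    using less by (simp add: flat_def)
next
  case equal
  have "((\<lambda>h. (flat k (0 + h) - flat k 0) / h) \<longlongrightarrow> 0) (at 0)"
    by (rule Lim_transform_eventually[OF flat_tendsto_0[of "k + 1"]])
       (auto simp: flat_def eventually_at_filter)
  then show ?thesis
    using equal by (simp add: DERIV_def flat_def)
next
  case greater
  then have "\<forall>\<^sub>F s in nhds t. flat k s = exp (- 1 / s) * inverse s ^ k"
    by (intro eventually_mono[OF eventually_nhds_in_open[of "{0<..}" t]]) (auto simp: flat_def field_simps)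
  moreover have "((\<lambda>s. exp (- 1 / s) * inverse s ^ k) has_real_derivative flat (k + 2) t - k * flat (k + 1) t) (at t)"
    using greater by (cases k) (auto intro!: derivative_eq_intros simp: flat_def field_simps power2_eq_square,
        metis One_nat_def gr0I mult.commute power_minus_mult)
  ultimately show ?thesis
    by (subst DERIV_cong_ev[OF refl _ refl])
qed

text \<open>A class of functions closed under directional derivatives, hence a coinduction invariant for
  \<^const>\<open>smooth\<close>.\<close>

inductive bump_algebra :: "'a::real_inner \<Rightarrow> real \<Rightarrow> ('a \<Rightarrow> real) \<Rightarrow> bool" for c r where
  const: "bump_algebra c r (\<lambda>_. a)"
| inner: "bump_algebra c r (\<lambda>x. x \<bullet> v)"
| add: "bump_algebra c r f \<Longrightarrow> bump_algebra c r g \<Longrightarrow> bump_algebra c r (\<lambda>x. f x + g x)"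
| mult: "bump_algebra c r f \<Longrightarrow> bump_algebra c r g \<Longrightarrow> bump_algebra c r (\<lambda>x. f x * g x)"
| flat: "bump_algebra c r (\<lambda>x. flat k (r - (x - c) \<bullet> (x - c)))"

lemma bump_algebra_derivative:
  assumes "bump_algebra c r f"
  shows "\<exists>f'. (\<forall>x. (f has_derivative f' x) (at x)) \<and> (\<forall>v. bump_algebra c r (\<lambda>x. f' x v))"
  using assms
proof induction
  case (const a)
  show ?case
    by (rule exI[of _ "\<lambda>_ _. 0"]) (auto intro: bump_algebra.const)
next
  case (inner v)
  show ?case
    by (rule exI[of _ "\<lambda>_ w. w \<bullet> v"]) (auto intro!: bump_algebra.const derivative_eq_intros)
next
  case (add f g)
  then obtain f' g' where "\<forall>x. (f has_derivative f' x) (at x)" "\<forall>v. bump_algebra c r (\<lambda>x. f' x v)"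
     "\<forall>x. (g has_derivative g' x) (at x)" "\<forall>v. bump_algebra c r (\<lambda>x. g' x v)" by blast
  then show ?case
    by (intro exI[of _ "\<lambda>x v. f' x v + g' x v"]) (auto intro!: bump_algebra.add derivative_eq_intros)
next
  case (mult f g)
  then obtain f' g' where "\<forall>x. (f has_derivative f' x) (at x)" "\<forall>v. bump_algebra c r (\<lambda>x. f' x v)"
     "\<forall>x. (g has_derivative g' x) (at x)" "\<forall>v. bump_algebra c r (\<lambda>x. g' x v)" by blast
  then show ?case
    using mult.hyps
    by (intro exI[of _ "\<lambda>x v. f x * g' x v + f' x v * g x"])
       (auto intro!: bump_algebra.add bump_algebra.mult has_derivative_mult)
next
  case (flat k)
  let ?q = "\<lambda>x. r - (x - c) \<bullet> (x - c)"
  \<comment> \<open>The chain rule, with the inner derivative 2 c.v - 2 x.v arranged as a constant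
    plus a multiple of \<open>x \<bullet> v\<close>, so that the result visibly belongs to the class
    again.\<close>
  let ?D = "\<lambda>x v. (flat (k + 2) (?q x) + (- real k) * flat (k + 1) (?q x)) * (2 * (c \<bullet> v) + (- 2) * (x \<bullet> v))"
  have "((\<lambda>x. flat k (?q x)) has_derivative ?D x) (at x)" for x
  proof -
    have "(?q has_derivative (\<lambda>v. 2 * (c \<bullet> v) + (- 2) * (x \<bullet> v))) (at x)"
      by (auto intro!: derivative_eq_intros simp: algebra_simps inner_commute)
    from has_derivative_compose[OF this flat_has_derivative[unfolded has_field_derivative_def]]
    show ?thesis by (simp add: algebra_simps)
  qed
  then show ?case
    by (intro exI[of _ ?D] conjI allI bump_algebra.intros) (auto simp only: inner_commute intro: bump_algebra.intros)
qed

lemma smooth_bump_algebra: "bump_algebra c r f \<Longrightarrow> smooth f"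
proof (coinduction arbitrary: f rule: smooth.coinduct)
  case smooth
  then obtain f' where f': "\<forall>x. (f has_derivative f' x) (at x)" "\<forall>v. bump_algebra c r (\<lambda>x. f' x v)"
    using bump_algebra_derivative by blast
  then have "frechet_derivative f (at x) = f' x" for x
    by (metis frechet_derivative_at)
  with f' show ?case
    by (auto simp: differentiable_def)
qed

lemma smooth_imp_continuous: "smooth f \<Longrightarrow> continuous_on UNIV f"
  by (metis smooth.cases continuous_at_imp_continuous_on differentiable_imp_continuous_within)

lemma test_function_bump:
  fixes c :: "real^'s"
  assumes "r > 0"
  obtains \<phi> where "test_function \<phi>" "\<And>x. 0 \<le> \<phi> x" "\<And>x. 0 < \<phi> x \<longleftrightarrow> x \<in> ball c r"
proof
  let ?\<phi> = "\<lambda>x. flat 0 (r\<^sup>2 - (x - c) \<bullet> (x - c))"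
  have pos: "0 < ?\<phi> x \<longleftrightarrow> x \<in> ball c r" for x
    using assms power2_less_imp_less[of "norm (x - c)" r] power_strict_mono[of "norm (x - c)" r 2]
    by (auto simp: flat_pos_iff dist_norm norm_minus_commute simp flip: power2_norm_eq_inner)
  then show "0 < ?\<phi> x \<longleftrightarrow> x \<in> ball c r" for x .
  show nonneg: "0 \<le> ?\<phi> x" for x
    by (simp add: flat_def)
  have "{x. ?\<phi> x \<noteq> 0} = ball c r"
    using pos nonneg by (auto simp: less_le)
  then show "test_function ?\<phi>"
    using assms by (auto simp: test_function_def intro: smooth_bump_algebra bump_algebra.flat)
qed

section \<open>The truncated power\<close>

lemma matrix_vector_mult_measurable [measurable]: "(*v) (A :: real^'n^'m) \<in> borel_measurable borel"
  by (simp add: borel_measurable_continuous_onI matrix_vector_mult_linear_continuous_on)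

lemma integral_matrix_substitution:
  fixes A :: "real^'n^'n" and g :: "real^'n \<Rightarrow> real"
  assumes A: "det A \<noteq> 0" and [measurable]: "g \<in> borel_measurable borel"
  shows "integrable lborel g \<longleftrightarrow> integrable lborel (\<lambda>x. g (A *v x))"
    and "(LINT x|lborel. g x) = \<bar>det A\<bar> * (LINT x|lborel. g (A *v x))"
proof -
  show "integrable lborel g \<longleftrightarrow> integrable lborel (\<lambda>x. g (A *v x))"
    using A by (subst lborel_eq_density_distr_matrix[OF A])
      (simp add: integrable_density integrable_distr_eq)
  show "(LINT x|lborel. g x) = \<bar>det A\<bar> * (LINT x|lborel. g (A *v x))"
    by (subst lborel_eq_density_distr_matrix[OF A]) (simp add: integral_density integral_distr)
qed

lemma det_unimodular:
  fixes U V :: "int^'n^'n"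
  assumes "U ** V = mat 1"
  shows "\<bar>det U\<bar> = 1"
proof -
  have "det U * det V = 1"
    using assms by (metis det_I det_mul)
  then show ?thesis
    by (metis abs_mult abs_zmult_eq_1 abs_one)
qed

lemma closed_nonneg_orthant: "closed (nonneg_orthant :: (real^'n) set)"
proof -
  have eq: "(nonneg_orthant :: (real^'n) set) = (\<Inter>i. {u :: real^'n. 0 \<le> u $ i})"
    by (auto simp: nonneg_orthant_def)
  show ?thesis
    unfolding eq by (intro closed_INT ballI closed_Collect_le continuous_intros)
qed

text \<open>Up to the order of the columns, \<open>M ** U = [H | 0]\<close>.\<close>

locale column_reduced = coordinate_split f d e for f :: "'s::finite \<Rightarrow> 'n::finite" and d e +
  fixes M :: "int^'n^'s" and U V :: "int^'n^'n" and H :: "int^'s^'s"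
  assumes UV: "U ** V = mat 1" and VU: "V ** U = mat 1"
    and zero: "\<And>i j. j \<notin> range f \<Longrightarrow> (M ** U) $ i $ j = 0"
    and H: "H = (\<chi> i j. (M ** U) $ i $ f j)" and det_H: "det H \<noteq> 0"
    and pointed: "\<And>u. u \<in> nonneg_orthant \<Longrightarrow> real_matrix M *v u = 0 \<Longrightarrow> u = 0"
begin

abbreviation "Hinv \<equiv> matrix_inv (real_matrix H)"

definition param :: "real^'s \<Rightarrow> (nat \<Rightarrow> real) \<Rightarrow> real^'n" where
  "param x w = real_matrix U *v join (Hinv *v x) w"

definition slice :: "real^'s \<Rightarrow> (nat \<Rightarrow> real) set" where
  "slice x = {w \<in> space (lborel_fun d). param x w \<in> nonneg_orthant}"

definition fiber_power :: "real^'s \<Rightarrow> real" where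
  "fiber_power x = measure (lborel_fun d) (slice x) / \<bar>det H\<bar>"

abbreviation "col_cone \<equiv> (*v) (real_matrix M) ` nonneg_orthant"

lemma det_real_H: "det (real_matrix H) \<noteq> 0"
  by (simp add: det_real_matrix det_H)

lemma H_Hinv [simp]: "real_matrix H *v (Hinv *v x) = x" and Hinv_H [simp]: "Hinv *v (real_matrix H *v x) = x"
proof -
  have "real_matrix H ** Hinv = mat 1 \<and> Hinv ** real_matrix H = mat 1"
    using det_real_H unfolding invertible_det_nz[symmetric] invertible_def matrix_inv_def by (rule someI_ex)
  then show "real_matrix H *v (Hinv *v x) = x" "Hinv *v (real_matrix H *v x) = x"
    by (simp_all add: matrix_vector_mul_assoc)
qed

lemma U_V [simp]: "real_matrix U *v (real_matrix V *v x) = x"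
  and V_U [simp]: "real_matrix V *v (real_matrix U *v x) = x"
  by (simp_all add: matrix_vector_mul_assoc UV VU flip: real_matrix_mult)

lemma M_U: "real_matrix M *v (real_matrix U *v v) = real_matrix H *v (\<chi> t. v $ f t)"
proof -
  have "(\<Sum>j\<in>UNIV. real_of_int ((M ** U) $ i $ j) * v $ j) = (\<Sum>j\<in>range f. real_of_int ((M ** U) $ i $ j) * v $ j)" for i
    by (rule sum.mono_neutral_right) (auto simp: zero)
  then have "real_matrix (M ** U) *v v = real_matrix H *v (\<chi> t. v $ f t)"
    by (simp add: vec_eq_iff matrix_vector_mult_def map_matrix_def H sum.reindex[OF inj_f])
  then show ?thesis
    by (simp add: matrix_vector_mul_assoc real_matrix_mult)
qed

lemma M_param [simp]: "real_matrix M *v param x w = x"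
  by (simp add: param_def M_U)

lemma param_tail: 
  assumes "real_matrix M *v u = x"
  shows "param x (tail (real_matrix V *v u)) = u"
proof -
  have "x = real_matrix H *v (\<chi> t. (real_matrix V *v u) $ f t)"
    using assms M_U[of "real_matrix V *v u"] by simp
  then have "Hinv *v x = (\<chi> t. (real_matrix V *v u) $ f t)"
    by simp
  then show ?thesis
    by (simp add: param_def)
qed

lemma tail_param: "w \<in> space (lborel_fun d) \<Longrightarrow> tail (real_matrix V *v param x w) = w"
  by (simp add: param_def tail_join)

lemma fiber_polytope_eq: "fiber_polytope M x = param x ` slice x"
proof (intro equalityI subsetI)
  fix u assume "u \<in> fiber_polytope M x"
  then have u: "u \<in> nonneg_orthant" "real_matrix M *v u = x"
    by (auto simp: fiber_polytope_def)
  then have "tail (real_matrix V *v u) \<in> slice x"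
    by (simp add: slice_def param_tail)
  then show "u \<in> param x ` slice x"
    using param_tail[OF u(2)] by (metis imageI)
qed (auto simp: fiber_polytope_def slice_def)

lemma slice_nonempty_iff: "slice x \<noteq> {} \<longleftrightarrow> x \<in> col_cone"
proof -
  have "slice x \<noteq> {} \<longleftrightarrow> fiber_polytope M x \<noteq> {}"
    by (simp add: fiber_polytope_eq)
  then show ?thesis
    by (auto simp: fiber_polytope_def)
qed

text \<open>The continuous function |M u| attains its minimum on the compact set of unit vectors of
  the orthant; \<open>pointed\<close> makes this minimum positive, and homogeneity extends the bound
  to the whole orthant.\<close>

lemma orthant_norm_bound:
  obtains C where "C > 0" "\<And>u. u \<in> nonneg_orthant \<Longrightarrow> norm u \<le> C * norm (real_matrix M *v u)"
proof -
  let ?K = "sphere 0 1 \<inter> nonneg_orthant :: (real^'n) set"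
  have "compact ?K"
    by (intro compact_Int_closed closed_nonneg_orthant compact_sphere)
  moreover have "axis (SOME i. True) 1 \<in> ?K"
    by (auto simp: nonneg_orthant_def norm_axis_1) (simp add: axis_def)
  then have "?K \<noteq> {}" by blast
  moreover have "continuous_on ?K (\<lambda>u. norm (real_matrix M *v u))"
    by (intro continuous_on_norm matrix_vector_mult_linear_continuous_on)
  ultimately obtain u0 where u0: "u0 \<in> ?K"
    "\<And>u. u \<in> ?K \<Longrightarrow> norm (real_matrix M *v u0) \<le> norm (real_matrix M *v u)"
    using continuous_attains_inf by metis
  define m where "m = norm (real_matrix M *v u0)"
  have m: "m > 0"
    using u0(1) pointed[of u0] by (auto simp: m_def)
  show thesis
  proof
    fix u :: "real^'n" assume u: "u \<in> nonneg_orthant"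
    show "norm u \<le> 1 / m * norm (real_matrix M *v u)"
    proof (cases "u = 0")
      case False
      have "m \<le> norm (real_matrix M *v (u /\<^sub>R norm u))"
        unfolding m_def using u False by (intro u0(2)) (auto simp: nonneg_orthant_def)
      also have "\<dots> = norm (real_matrix M *v u) / norm u"
        by (simp add: matrix_vector_mult_scaleR divide_inverse_commute)
      finally show ?thesis
        using m False by (simp add: field_simps)
    qed simp
  qed (use m in simp)
qed

text \<open>The coordinates w are entries of V u with u in the orthant and M u = x, so |x| bounds
  them. One box serves all x in a ball; it later provides the dominating function.\<close>

lemma slice_bounded: "\<exists>K. \<forall>x. norm x \<le> R \<longrightarrow> slice x \<subseteq> ({..<d} \<rightarrow>\<^sub>E {- K..K})"
proof -
  obtain C where C: "C > 0" "\<And>u. u \<in> nonneg_orthant \<Longrightarrow> norm u \<le> C * norm (real_matrix M *v u)"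
    using orthant_norm_bound by blast
  obtain B where B: "B > 0" "\<And>u. norm (real_matrix V *v u) \<le> B * norm u"
    using linear_bounded_pos[of "(*v) (real_matrix V)"] by auto
  show ?thesis
  proof (intro exI allI impI)
    fix x :: "real^'s" assume x: "norm x \<le> R"
    show "slice x \<subseteq> ({..<d} \<rightarrow>\<^sub>E {- (B * (C * R))..B * (C * R)})"
    proof
      fix w assume "w \<in> slice x"
      then have w: "w \<in> space (lborel_fun d)" "param x w \<in> nonneg_orthant"
        by (auto simp: slice_def)
      have "norm (param x w) \<le> C * norm x"
        using C(2)[OF w(2)] by simp
      also have "\<dots> \<le> C * R"
        using x C(1) by simp
      finally have "B * norm (param x w) \<le> B * (C * R)"
        using B(1) by simp
      then have n: "norm (real_matrix V *v param x w) \<le> B * (C * R)"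
        using B(2) order_trans by blast
      have "w k \<in> {- (B * (C * R))..B * (C * R)}" if "k < d" for k
      proof -
        have "w k = tail (real_matrix V *v param x w) k"
          by (simp add: tail_param w)
        also have "\<dots> = (real_matrix V *v param x w) $ e k"
          using that by (simp add: tail_def)
        finally show ?thesis
          using component_le_norm_cart[of "real_matrix V *v param x w" "e k"] n by auto
      qed
      then show "w \<in> ({..<d} \<rightarrow>\<^sub>E {- (B * (C * R))..B * (C * R)})"
        using w(1) by (auto simp: space_PiM PiE_iff)
    qed
  qed
qed

lemma measurable_param [measurable]: "(\<lambda>(x, w). param x w) \<in> lborel \<Otimes>\<^sub>M lborel_fun d \<rightarrow>\<^sub>M borel"
proof -
  have "(\<lambda>p. (Hinv *v fst p, snd p)) \<in> lborel \<Otimes>\<^sub>M lborel_fun d \<rightarrow>\<^sub>M lborel \<Otimes>\<^sub>M lborel_fun d"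
    by (intro measurable_Pair measurable_compose[OF measurable_fst] measurable_snd)
       (simp add: matrix_vector_mult_measurable)
  from measurable_compose[OF measurable_compose[OF this measurable_join] matrix_vector_mult_measurable[of "real_matrix U"]]
  show ?thesis
    by (simp add: param_def case_prod_unfold)
qed

lemma measurable_param2 [measurable]: "param x \<in> lborel_fun d \<rightarrow>\<^sub>M borel"
  using measurable_Pair2[OF measurable_param, of x] by simp

lemma sets_nonneg_orthant [measurable]: "nonneg_orthant \<in> sets borel"
  by (simp add: closed_nonneg_orthant)

lemma sets_slice [measurable]: "slice x \<in> sets (lborel_fun d)"
proof -
  have "slice x = param x -` nonneg_orthant \<inter> space (lborel_fun d)"
    by (auto simp: slice_def)
  then show ?thesis
    using measurable_sets[OF measurable_param2[of x] sets_nonneg_orthant] by simp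
qed

lemma emeasure_box_finite: "emeasure (lborel_fun d) ({..<d} \<rightarrow>\<^sub>E {- K..K}) < \<infinity>"
  by (subst lborel_fun.emeasure_PiM) (auto simp: emeasure_lborel_Icc_eq power_less_top_ennreal)

lemma emeasure_slice_finite: "emeasure (lborel_fun d) (slice x) < \<infinity>"
proof -
  obtain K where "slice x \<subseteq> ({..<d} \<rightarrow>\<^sub>E {- K..K})"
    using slice_bounded[of "norm x"] by auto
  then have "emeasure (lborel_fun d) (slice x) \<le> emeasure (lborel_fun d) ({..<d} \<rightarrow>\<^sub>E {- K..K})"
    by (intro emeasure_mono sets_PiM_I_finite) auto
  then show ?thesis
    using emeasure_box_finite by (rule le_less_trans)
qed

end

lemma test_function_continuous: "test_function \<phi> \<Longrightarrow> continuous_on UNIV \<phi>"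
  by (simp add: test_function_def smooth_imp_continuous)

lemma test_function_measurable: "test_function \<phi> \<Longrightarrow> \<phi> \<in> borel_measurable borel"
  by (simp add: test_function_continuous borel_measurable_continuous_onI)

lemma test_function_bounded:
  assumes "test_function \<phi>"
  shows "\<exists>B R. \<forall>x. \<bar>\<phi> x\<bar> \<le> B \<and> (\<phi> x \<noteq> 0 \<longrightarrow> norm x \<le> R)"
proof -
  let ?S = "closure {x. \<phi> x \<noteq> 0}"
  have S: "compact ?S"
    using assms by (simp add: test_function_def)
  then obtain R where R: "\<And>x. x \<in> ?S \<Longrightarrow> norm x \<le> R"
    using compact_imp_bounded[OF S] unfolding bounded_iff by blast
  have "compact (\<phi> ` ?S)"
    using S test_function_continuous[OF assms] by (intro compact_continuous_image) (auto intro: continuous_on_subset)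
  then have "bounded (\<phi> ` ?S)"
    by (rule compact_imp_bounded)
  then obtain B where "\<forall>y\<in>\<phi> ` ?S. norm y \<le> B"
    unfolding bounded_iff by blast
  then have B: "\<bar>\<phi> x\<bar> \<le> B" if "x \<in> ?S" for x
    using that by simp
  have "x \<in> ?S" if "\<phi> x \<noteq> 0" for x
    by (rule subsetD[OF closure_subset]) (simp add: that)
  then have "\<bar>\<phi> x\<bar> \<le> \<bar>B\<bar> \<and> (\<phi> x \<noteq> 0 \<longrightarrow> norm x \<le> R)" for x
    using B[of x] R[of x] by (cases "\<phi> x = 0") auto
  then show ?thesis by blast
qed

section \<open>Integration along the fibers and continuity of the slice volume\<close>

context column_reduced
begin

lemma det_real_U: "\<bar>det (real_matrix U)\<bar> = 1"
  using det_unimodular[OF UV] by (simp add: det_real_matrix flip: of_int_abs)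

text \<open>The region of integration is unbounded, but where the integrand is nonzero |M u| is at
  most R, hence |u| is at most C R.\<close>

lemma integrable_test_function_orthant:
  assumes \<phi>: "test_function \<phi>"
  shows "set_integrable lborel nonneg_orthant (\<lambda>u. \<phi> (real_matrix M *v u))"
proof -
  note [measurable] = test_function_measurable[OF \<phi>]
  obtain B R where BR: "\<And>x. \<bar>\<phi> x\<bar> \<le> B" "\<And>x. \<phi> x \<noteq> 0 \<Longrightarrow> norm x \<le> R"
    using test_function_bounded[OF \<phi>] by blast
  obtain C where C: "C > 0" "\<And>u. u \<in> nonneg_orthant \<Longrightarrow> norm u \<le> C * norm (real_matrix M *v u)"
    using orthant_norm_bound by blast
  let ?A = "nonneg_orthant \<inter> cball 0 (C * R) :: (real^'n) set"
  have "integrable lborel (\<lambda>u. indicator ?A u *\<^sub>R \<phi> (real_matrix M *v u))"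
  proof (rule integrableI_bounded_set_indicator[where B = B])
    have "emeasure lborel ?A \<le> emeasure lborel (cball 0 (C * R) :: (real^'n) set)"
      by (intro emeasure_mono) auto
    also have "\<dots> < \<infinity>"
      by (rule emeasure_bounded_finite[OF bounded_cball])
    finally show "emeasure lborel ?A < \<infinity>" .
  qed (auto simp: BR)
  moreover have "(\<lambda>u. indicator ?A u *\<^sub>R \<phi> (real_matrix M *v u)) = (\<lambda>u. indicator nonneg_orthant u *\<^sub>R \<phi> (real_matrix M *v u))"
  proof
    fix u
    have "norm u \<le> C * R" if "u \<in> nonneg_orthant" "\<phi> (real_matrix M *v u) \<noteq> 0"
    proof -
      have "C * norm (real_matrix M *v u) \<le> C * R"
        using BR(2)[OF that(2)] C(1) by simp
      with C(2)[OF that(1)] show ?thesis by simp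
    qed
    then show "indicator ?A u *\<^sub>R \<phi> (real_matrix M *v u) = indicator nonneg_orthant u *\<^sub>R \<phi> (real_matrix M *v u)"
      by (auto simp: indicator_def)
  qed
  ultimately show ?thesis
    by (simp only: set_integrable_def)
qed

lemma fiber_power_identity:
  assumes \<phi>: "test_function \<phi>"
  shows "integrable lborel (\<lambda>x. fiber_power x * \<phi> x)"
    and "(LINT x|lborel. fiber_power x * \<phi> x) = (LINT u:nonneg_orthant|lborel. \<phi> (real_matrix M *v u))"
proof -
  interpret pair_sigma_finite "lborel :: (real^'s) measure" "lborel_fun d" ..
  note [measurable] = test_function_measurable[OF \<phi>]
  define g where "g u = indicator nonneg_orthant u *\<^sub>R \<phi> (real_matrix M *v u)" for u
  define F where "F x = measure (lborel_fun d) (slice x) * \<phi> x" for x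
  have [measurable]: "g \<in> borel_measurable borel"
    unfolding g_def by measurable
  have int_g: "integrable lborel g"
    using integrable_test_function_orthant[OF \<phi>] by (simp add: set_integrable_def g_def[abs_def])
  have nz: "det (real_matrix U) \<noteq> 0"
    using det_real_U by auto
  have inner: "(LINT w|lborel_fun d. g (param x w)) = F x" for x
  proof -
    have "(LINT w|lborel_fun d. g (param x w)) = (LINT w|lborel_fun d. indicator (slice x) w * \<phi> x)"
      by (rule Bochner_Integration.integral_cong) (auto simp: g_def slice_def indicator_def)
    also have "\<dots> = F x"
      using emeasure_slice_finite[of x] by (simp add: F_def)
    finally show ?thesis .
  qed
  \<comment> \<open>In the variable y = Hinv x the parametrisation is U after \<open>join\<close>,
    so the volume-preserving substitution by \<open>U\<close> comes before Fubini and the factor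
    |det H| enters only when y is replaced by x.\<close>
  have param_H: "param (real_matrix H *v y) w = real_matrix U *v join y w" for y w
    by (simp add: param_def)
  have "integrable lborel (\<lambda>v. g (real_matrix U *v v))"
    and "(LINT v|lborel. g (real_matrix U *v v)) = (LINT u|lborel. g u)"
    using integral_matrix_substitution[OF nz, of g] int_g by (simp_all add: det_real_U)
  then have "integrable (distr (lborel \<Otimes>\<^sub>M lborel_fun d) borel (\<lambda>(y, w). join y w)) (\<lambda>v. g (real_matrix U *v v))"
    and "integral\<^sup>L (distr (lborel \<Otimes>\<^sub>M lborel_fun d) borel (\<lambda>(y, w). join y w)) (\<lambda>v. g (real_matrix U *v v))
      = (LINT u|lborel. g u)"
    by (simp_all only: lborel_join)
  then have int2: "integrable (lborel \<Otimes>\<^sub>M lborel_fun d) (\<lambda>(y, w). g (real_matrix U *v join y w))"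
    and eq2: "(LINT p|(lborel \<Otimes>\<^sub>M lborel_fun d). (case p of (y, w) \<Rightarrow> g (real_matrix U *v join y w))) = (LINT u|lborel. g u)"
    by (simp_all add: integrable_distr_eq integral_distr case_prod_unfold)
  have int: "integrable lborel (\<lambda>y. F (real_matrix H *v y))"
    and eq3: "(LINT y|lborel. F (real_matrix H *v y)) = (LINT u|lborel. g u)"
    using integrable_fst'[OF int2] integral_fst'[OF int2] eq2
    by (simp_all add: inner flip: param_H)
  \<comment> \<open>Integrability is known for F after H; transferring it back to \<open>F\<close>
    requires measurability of \<open>F\<close>, which holds because \<open>F\<close> is a parameter
    integral.\<close>
  have "(\<lambda>x. LINT w|lborel_fun d. g (param x w)) \<in> borel_measurable lborel"
    by measurable
  then have "F \<in> borel_measurable borel"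
    by (simp add: inner)
  then have "integrable lborel F" "(LINT x|lborel. F x) = \<bar>real_of_int (det H)\<bar> * (LINT u|lborel. g u)"
    using integral_matrix_substitution[OF det_real_H, of F] int eq3 by (simp_all add: det_real_matrix)
  moreover have "fiber_power x * \<phi> x = F x / \<bar>real_of_int (det H)\<bar>" for x
    by (simp add: fiber_power_def F_def)
  ultimately show "integrable lborel (\<lambda>x. fiber_power x * \<phi> x)"
    "(LINT x|lborel. fiber_power x * \<phi> x) = (LINT u:nonneg_orthant|lborel. \<phi> (real_matrix M *v u))"
    using det_H by (simp_all add: set_lebesgue_integral_def g_def)
qed

text \<open>Either the i-th coordinate involves some w_k, and then its zero set is a hyperplane in
  w, or it depends on x alone. Only constraints of the first kind can change sign as x varies within
  the cone, and they do so off a null set.\<close>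

lemma param_component_cases:
  "(\<forall>x. AE w in lborel_fun d. param x w $ i \<noteq> 0) \<or> (\<forall>x w w'. param x w $ i = param x w' $ i)"
proof -
  have inner: "param x w $ i = row i (real_matrix U) \<bullet> join (Hinv *v x) w" for x w
    by (simp add: param_def matrix_vector_mult_def inner_vec_def row_def)
  show ?thesis
  proof (cases "\<exists>k<d. row i (real_matrix U) $ e k \<noteq> 0")
    case True
    then obtain k where "k < d" "row i (real_matrix U) $ e k \<noteq> 0" by blast
    then have "AE w in lborel_fun d. row i (real_matrix U) \<bullet> join y w \<noteq> 0" for y
      by (intro AE_I'[OF null_sets_join_hyperplane[of k "row i (real_matrix U)" y 0]]) auto
    then show ?thesis
      by (simp add: inner)
  next
    case False
    then show ?thesis
      by (auto simp: inner inner_join)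
  qed
qed

lemma continuous_on_fiber_power: "continuous_on col_cone fiber_power"
  unfolding continuous_on_sequentially
proof (intro ballI allI impI, elim conjE)
  fix X :: "nat \<Rightarrow> real^'s" and a
  assume a: "a \<in> col_cone" and X: "\<forall>n. X n \<in> col_cone" "X \<longlonglongrightarrow> a"
  obtain R where R: "\<And>n. norm (X n) \<le> R"
    using X(2) convergent_imp_Bseq convergentI by (metis Bseq_def)
  obtain K where K: "\<And>x. norm x \<le> R \<Longrightarrow> slice x \<subseteq> ({..<d} \<rightarrow>\<^sub>E {- K..K})"
    using slice_bounded by blast
  let ?B = "{..<d} \<rightarrow>\<^sub>E {- K..K}"
  have [measurable]: "?B \<in> sets (lborel_fun d)"
    by (intro sets_PiM_I_finite) auto
  \<comment> \<open>For fixed w the parametrisation is affine in x: \<open>join\<close> splits into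
    a part with w and a part linear in x.\<close>
  have cont: "(\<lambda>n. param (X n) w $ i) \<longlonglongrightarrow> param a w $ i" for w i
  proof -
    have "param x w $ i = (real_matrix U *v join 0 w) $ i + (real_matrix U *v join (Hinv *v x) (\<lambda>_. 0)) $ i" for x
    proof -
      have "join (Hinv *v x) w = join 0 w + join (Hinv *v x) (\<lambda>_. 0)"
        by (simp flip: join_add)
      then show ?thesis
        by (simp add: param_def matrix_vector_right_distrib)
    qed
    moreover have "linear (\<lambda>x. (real_matrix U *v join (Hinv *v x) (\<lambda>_. 0)) $ i)"
    proof (rule linearI)
      fix x y :: "real^'s" and c :: real
      have "join (Hinv *v (x + y)) (\<lambda>_. 0) = join (Hinv *v x) (\<lambda>_. 0) + join (Hinv *v y) (\<lambda>_. 0)"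
        by (simp add: matrix_vector_right_distrib flip: join_add)
      then show "(real_matrix U *v join (Hinv *v (x + y)) (\<lambda>_. 0)) $ i
          = (real_matrix U *v join (Hinv *v x) (\<lambda>_. 0)) $ i + (real_matrix U *v join (Hinv *v y) (\<lambda>_. 0)) $ i"
        by (simp add: matrix_vector_right_distrib)
      have "join (Hinv *v (c *\<^sub>R x)) (\<lambda>_. 0) = c *\<^sub>R join (Hinv *v x) (\<lambda>_. 0)"
        using join_scaleR[of c "Hinv *v x" "\<lambda>_. 0"] by (simp add: matrix_vector_mult_scaleR)
      then show "(real_matrix U *v join (Hinv *v (c *\<^sub>R x)) (\<lambda>_. 0)) $ i
          = c *\<^sub>R (real_matrix U *v join (Hinv *v x) (\<lambda>_. 0)) $ i"
        by (simp add: matrix_vector_mult_scaleR)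
    qed
    then have "(\<lambda>n. (real_matrix U *v join (Hinv *v X n) (\<lambda>_. 0)) $ i)
        \<longlonglongrightarrow> (real_matrix U *v join (Hinv *v a) (\<lambda>_. 0)) $ i"
      using X(2) by (intro bounded_linear.tendsto[of "\<lambda>x. (real_matrix U *v join (Hinv *v x) (\<lambda>_. 0)) $ i"])
        (simp_all add: linear_conv_bounded_linear)
    ultimately show ?thesis
      by (simp add: tendsto_add)
  qed
  have ev: "\<forall>\<^sub>F n in sequentially. (0 \<le> param (X n) w $ i) = (0 \<le> param a w $ i)"
    if w: "param a w $ i \<noteq> 0 \<or> (\<forall>x w w'. param x w $ i = param x w' $ i)" for w i
  proof (cases "\<forall>x w w'. param x w $ i = param x w' $ i")
    \<comment> \<open>Here the coordinate is a function of x alone, and a point in the nonempty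
      slice over x shows that it is nonnegative throughout the cone, even where it is 0.\<close>
    case True
    have "0 \<le> param x w $ i" if "x \<in> col_cone" for x
    proof -
      have "slice x \<noteq> {}"
        using that by (simp only: slice_nonempty_iff)
      then obtain w' where "w' \<in> slice x" by blast
      then have "0 \<le> param x w' $ i"
        by (simp add: slice_def nonneg_orthant_def)
      then show ?thesis using True by metis
    qed
    then show ?thesis using a X(1) by simp
  next
    case False
    with w consider "param a w $ i > 0" | "param a w $ i < 0" by force
    then show ?thesis
    proof cases
      case 1
      then show ?thesis
        using order_tendstoD(1)[OF cont 1] by (auto elim: eventually_mono)
    next
      case 2
      then show ?thesis
        using order_tendstoD(2)[OF cont 2] by (auto elim: eventually_mono)
    qed
  qed
  have "AE w in lborel_fun d. \<forall>i. param a w $ i \<noteq> 0 \<or> (\<forall>x w w'. param x w $ i = param x w' $ i)"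
    unfolding AE_all_countable
  proof
    fix i show "AE w in lborel_fun d. param a w $ i \<noteq> 0 \<or> (\<forall>x w w'. param x w $ i = param x w' $ i)"
      using param_component_cases[of i]
    proof
      assume "\<forall>x. AE w in lborel_fun d. param x w $ i \<noteq> 0"
      then have "AE w in lborel_fun d. param a w $ i \<noteq> 0" by blast
      then show ?thesis by eventually_elim blast
    qed (intro AE_I2 disjI2)
  qed
  then have ae: "AE w in lborel_fun d. (\<lambda>n. indicat_real (slice (X n)) w) \<longlonglongrightarrow> indicat_real (slice a) w"
  proof eventually_elim
    case (elim w)
    then have "\<forall>\<^sub>F n in sequentially. \<forall>i. (0 \<le> param (X n) w $ i) = (0 \<le> param a w $ i)"
      by (intro eventually_all_finite) (rule ev, blast)
    then have "\<forall>\<^sub>F n in sequentially. indicat_real (slice (X n)) w = indicat_real (slice a) w"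
      by eventually_elim (simp add: slice_def nonneg_orthant_def indicator_def)
    then show ?case
      by (simp add: tendsto_eventually)
  qed
  \<comment> \<open>Dominated convergence, with the indicator of the common box \<open>?B\<close> as
    dominating function.\<close>
  have "(\<lambda>n. LINT w|lborel_fun d. indicat_real (slice (X n)) w) \<longlonglongrightarrow> (LINT w|lborel_fun d. indicat_real (slice a) w)"
  proof (rule integral_dominated_convergence[OF _ _ _ ae])
    show "integrable (lborel_fun d) (indicat_real ?B)"
      using emeasure_box_finite[of K] by (simp add: integrable_indicator_iff)
    show "AE w in lborel_fun d. norm (indicat_real (slice (X n)) w) \<le> indicat_real ?B w" for n
      using K[OF R[of n]] by (auto simp: indicator_def)
  qed simp_all
  then have "(\<lambda>n. measure (lborel_fun d) (slice (X n))) \<longlonglongrightarrow> measure (lborel_fun d) (slice a)"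
    by simp
  then show "(fiber_power \<circ> X) \<longlonglongrightarrow> fiber_power a"
    using tendsto_divide[OF _ tendsto_const, of _ "measure (lborel_fun d) (slice a)" sequentially "real_of_int \<bar>det H\<bar>"] det_H
    by (simp add: fiber_power_def[abs_def] o_def)
qed

lemma is_truncated_power_fiber_power: "is_truncated_power M fiber_power"
  unfolding is_truncated_power_def
proof (intro conjI allI impI)
  fix x assume "x \<notin> col_cone"
  then show "fiber_power x = 0"
    using slice_nonempty_iff[of x] by (simp add: fiber_power_def)
qed (fact fiber_power_identity integrable_test_function_orthant continuous_on_fiber_power)+

end

section \<open>Uniqueness of the truncated power\<close>

text \<open>A positive difference at x persists, by continuity on the cone, at nearby images of
  strictly positive vectors. These images form an open set because \<open>M\<close> is surjective,
  so the difference is positive on a ball inside the cone, and a bump function on that ball violates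
  the equality of the two integrals.\<close>

lemma is_truncated_power_le:
  fixes M :: "int^'n^'s"
  assumes surj: "surj ((*v) (real_matrix M))"
    and T1: "is_truncated_power M T1" and T2: "is_truncated_power M T2"
    and x: "x \<in> (*v) (real_matrix M) ` nonneg_orthant"
  shows "T1 x \<le> T2 x"
proof (rule ccontr)
  let ?C = "(*v) (real_matrix M) ` nonneg_orthant"
  let ?O = "{u :: real^'n. \<forall>i. 0 < u $ i}"
  define G where "G = (*v) (real_matrix M) ` ?O"
  define D where "D y = T1 y - T2 y" for y
  assume "\<not> T1 x \<le> T2 x"
  then have pos: "0 < D x" by (simp add: D_def)
  have O_eq: "?O = (\<Inter>i. {u. 0 < u $ i})" by auto
  have "open ?O"
    unfolding O_eq by (intro open_INT finite ballI open_Collect_less continuous_intros)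
  then have G: "open G"
    unfolding G_def using surj by (intro open_surjective_linear_image) auto
  have GC: "G \<subseteq> ?C"
    unfolding G_def by (intro image_mono) (auto simp: nonneg_orthant_def less_imp_le)
  have contC: "continuous_on ?C D"
    using T1 T2 unfolding is_truncated_power_def D_def[abs_def] by (intro continuous_intros) auto
  obtain u where u: "u \<in> nonneg_orthant" "x = real_matrix M *v u"
    using x by blast
  \<comment> \<open>The vector 1 has all entries 1; adding a small multiple of it moves u into the
    open orthant, so points on the boundary of the cone are reached as limits.\<close>
  define X where "X n = real_matrix M *v (u + inverse (real (Suc n)) *\<^sub>R 1)" for n
  have XG: "X n \<in> G" for n
    unfolding X_def G_def using u(1) by (intro imageI) (auto simp: nonneg_orthant_def intro: add_nonneg_pos)
  have "(\<lambda>n. u + inverse (real (Suc n)) *\<^sub>R 1) \<longlonglongrightarrow> u + 0 *\<^sub>R 1"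
    by (intro tendsto_intros LIMSEQ_inverse_real_of_nat)
  then have "X \<longlonglongrightarrow> x"
    unfolding X_def u(2)
    by (intro bounded_linear.tendsto[of "(*v) (real_matrix M)"]) auto
  then have "(D \<circ> X) \<longlonglongrightarrow> D x"
    using contC x XG GC unfolding continuous_on_sequentially by blast
  then have "\<forall>\<^sub>F n in sequentially. 0 < D (X n)"
    using pos order_tendstoD(1) by (fastforce simp: o_def)
  then obtain n where n: "0 < D (X n)"
    using eventually_happens by fastforce
  have "open (G \<inter> D -` {0<..})"
    using continuous_on_subset[OF contC GC] G by (intro continuous_open_preimage) auto
  then obtain r where r: "r > 0" "ball (X n) r \<subseteq> G \<inter> D -` {0<..}"
    using XG n openE[of "G \<inter> D -` {0<..}" "X n"] by auto
  obtain \<phi> where \<phi>: "test_function \<phi>" "\<And>y. 0 \<le> \<phi> y" "\<And>y. 0 < \<phi> y \<longleftrightarrow> y \<in> ball (X n) r"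
    using test_function_bump[OF r(1)] by metis
  have int: "integrable lborel (\<lambda>y. T1 y * \<phi> y)" "integrable lborel (\<lambda>y. T2 y * \<phi> y)"
    and eq: "(LINT y|lborel. T1 y * \<phi> y) = (LINT y|lborel. T2 y * \<phi> y)"
    using T1 T2 \<phi>(1) unfolding is_truncated_power_def by metis+
  have "D y * \<phi> y \<ge> 0" for y
  proof (cases "y \<in> ball (X n) r")
    case True
    then show ?thesis using r(2) \<phi>(2) by (intro mult_nonneg_nonneg) (auto intro: less_imp_le)
  next
    case False
    then have "\<phi> y = 0" using \<phi>(2,3)[of y] by linarith
    then show ?thesis by simp
  qed
  moreover have "integrable lborel (\<lambda>y. D y * \<phi> y)" "(LINT y|lborel. D y * \<phi> y) = 0"
    using int eq by (simp_all add: D_def left_diff_distrib)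
  ultimately have "AE y in lborel. D y * \<phi> y = 0"
    using integral_nonneg_eq_0_iff_AE[of lborel "\<lambda>y. D y * \<phi> y"] by simp
  then have "AE y in lborel. y \<notin> ball (X n) r"
  proof eventually_elim
    case (elim y)
    show ?case
    proof
      assume y: "y \<in> ball (X n) r"
      then have "0 < D y" using r(2) by auto
      moreover have "0 < \<phi> y" using y \<phi>(3) by simp
      ultimately show False using elim by simp
    qed
  qed
  then have "ball (X n) r \<in> null_sets lborel"
    by (subst AE_iff_null_sets) auto
  then have "negligible (ball (X n) r)"
    by (simp add: negligible_iff_null_sets null_sets_completionI)
  then show False
    using r(1) open_not_negligible[of "ball (X n) r"] by simp
qed

lemma is_truncated_power_unique:
  fixes M :: "int^'n^'s"
  assumes "surj ((*v) (real_matrix M))" "is_truncated_power M T1" "is_truncated_power M T2"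
  shows "T1 = T2"
proof
  fix x
  show "T1 x = T2 x"
  proof (cases "x \<in> (*v) (real_matrix M) ` nonneg_orthant")
    case True
    then show ?thesis
      using is_truncated_power_le[OF assms(1)] assms(2,3) by (meson order_antisym)
  next
    case False
    then show ?thesis
      using assms(2,3) by (simp add: is_truncated_power_def)
  qed
qed

section \<open>Lattice automorphisms and invariance of volume\<close>

lemma integer_points_matrix_mult:
  "x \<in> integer_points \<Longrightarrow> real_matrix A *v x \<in> integer_points"
  by (auto simp: integer_points_def matrix_vector_mult_def map_matrix_def intro!: Ints_sum Ints_mult)

lemma det_in_Ints:
  fixes A :: "real^'n^'n"
  assumes "\<And>i j. A $ i $ j \<in> \<int>"
  shows "det A \<in> \<int>"
  unfolding det_def by (intro Ints_sum Ints_mult Ints_prod assms Ints_of_int)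

text \<open>The matrices of g and of its inverse have integer entries, so their determinants are
  integers with product 1.\<close>

lemma det_lattice_automorphism:
  fixes g :: "real^'n \<Rightarrow> real^'n"
  assumes "linear g" "bij g" and int: "\<And>v. g v \<in> integer_points \<longleftrightarrow> v \<in> integer_points"
  shows "\<bar>det (matrix g)\<bar> = 1"
proof -
  have lin: "linear (inv g)"
    using assms(1,2) by (simp add: bij_is_inj inj_linear_imp_inv_linear)
  have inv_int: "inv g v \<in> integer_points \<longleftrightarrow> v \<in> integer_points" for v
    using int[of "inv g v"] assms(2) by (simp add: bij_is_surj surj_f_inv_f)
  have axis: "axis j 1 \<in> integer_points" for j :: 'n
    by (auto simp: integer_points_def axis_def)
  have "g (axis j 1) \<in> integer_points" "inv g (axis j 1) \<in> integer_points" for j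
    by (simp_all add: int inv_int axis)
  then have "det (matrix g) \<in> \<int>" "det (matrix (inv g)) \<in> \<int>"
    by (auto intro!: det_in_Ints simp: matrix_def integer_points_def)
  then obtain a b where ab: "det (matrix g) = of_int a" "det (matrix (inv g)) = of_int b"
    by (auto elim!: Ints_cases)
  have "matrix g ** matrix (inv g) = mat 1"
    using matrix_compose[OF lin assms(1)] bij_is_surj[OF assms(2)] by (simp add: surj_iff matrix_id_mat_1)
  then have "det (matrix g) * det (matrix (inv g)) = 1"
    by (metis det_I det_mul)
  then have "a * b = 1"
    unfolding ab by (simp flip: of_int_mult)
  then have "\<bar>a\<bar> = 1"
    by (metis abs_mult abs_zmult_eq_1 abs_one)
  then show ?thesis
    unfolding ab by (metis of_int_1 of_int_abs)
qed

lemma emeasure_lborel_affine_vimage: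
  fixes g :: "real^'n \<Rightarrow> real^'n"
  assumes "linear g" "\<bar>det (matrix g)\<bar> = 1" and B: "B \<in> sets borel"
  shows "emeasure lborel ((\<lambda>v. g (v - c) + c') -` B) = emeasure lborel B"
proof -
  have shift: "emeasure lborel ((\<lambda>v. v + z) -` S) = emeasure lborel S"
    if "S \<in> sets borel" for z :: "real^'n" and S
  proof -
    have "emeasure lborel S = emeasure (distr lborel borel ((+) z)) S"
      by (simp only: lborel_distr_plus)
    then show ?thesis
      using that by (simp add: emeasure_distr add.commute[of _ z])
  qed
  have [measurable]: "g \<in> borel_measurable borel"
    using assms(1) by (simp add: borel_measurable_continuous_onI linear_continuous_on linear_conv_bounded_linear)
  have B': "(\<lambda>v. v + c') -` B \<in> sets borel"
    using measurable_sets[of "\<lambda>v. v + c'" borel borel B] B by simp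
  then have B'': "g -` ((\<lambda>v. v + c') -` B) \<in> sets borel"
    using measurable_sets[of g borel borel] by simp
  have "(\<lambda>v. g (v - c) + c') -` B = (\<lambda>v. v + (- c)) -` (g -` ((\<lambda>v. v + c') -` B))"
    by auto
  then have "emeasure lborel ((\<lambda>v. g (v - c) + c') -` B) = emeasure lborel (g -` ((\<lambda>v. v + c') -` B))"
    using shift[OF B'', of "- c"] by simp
  also have "\<dots> = emeasure lborel ((\<lambda>v. v + c') -` B)"
    using emeasure_lborel_linear_vimage[OF assms(1) _ B'] assms(2) by force
  finally show ?thesis
    using shift[OF B] by simp
qed

section \<open>The relative volume\<close>

context column_reduced
begin

lemma CARD_eq: "CARD('n) = CARD('s) + d"
proof -
  have "card (- range f) = d"
    using bij_betw_same_card[OF bij_e] by simp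
  moreover have "card (range f) = CARD('s)"
    by (simp add: card_image inj_f)
  ultimately show ?thesis
    using card_Un_disjoint[of "range f" "- range f"] by simp
qed

lemma surj_M: "surj ((*v) (real_matrix M))"
  unfolding surj_def by (intro allI exI) (rule M_param[symmetric])

lemma truncated_power_eq: "truncated_power M = fiber_power"
  unfolding truncated_power_def
  using is_truncated_power_fiber_power is_truncated_power_unique[OF surj_M] by blast

lemma kernel_iff: "real_matrix M *v x = 0 \<longleftrightarrow> (\<forall>t. (real_matrix V *v x) $ f t = 0)"
proof -
  have "real_matrix M *v x = real_matrix H *v (\<chi> t. (real_matrix V *v x) $ f t)"
    using M_U[of "real_matrix V *v x"] by simp
  moreover have "real_matrix H *v y = 0 \<longleftrightarrow> y = 0" for y
    by (metis Hinv_H matrix_vector_mult_0_right)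
  ultimately show ?thesis
    by (simp add: vec_eq_iff)
qed

text \<open>Since M U = [H | 0] with H nonsingular, \<open>U\<close> carries the coordinate subspace
  complementary to \<open>range f\<close> onto the kernel of \<open>M\<close>.\<close>

lemma dim_kernel: "dim {x. real_matrix M *v x = 0} = d"
proof -
  let ?S = "{v :: real^'n. \<forall>i. i \<notin> - range f \<longrightarrow> v $ i = 0}"
  have "{x. real_matrix M *v x = 0} = (*v) (real_matrix U) ` ?S"
  proof (intro equalityI subsetI)
    fix x assume "x \<in> {x. real_matrix M *v x = 0}"
    then have "real_matrix V *v x \<in> ?S"
      by (auto simp: kernel_iff)
    then show "x \<in> (*v) (real_matrix U) ` ?S"
      by (intro image_eqI[of _ _ "real_matrix V *v x"]) simp_all
  qed (auto simp: kernel_iff)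
  moreover have "dim ((*v) (real_matrix U) ` ?S) = dim ?S"
    by (intro dim_image_eq) (auto intro!: inj_on_inverseI[of _ "(*v) (real_matrix V)"])
  moreover have "dim ?S = card (- range f)"
    unfolding dim_vec_eq[symmetric] by (rule dim_substandard_cart)
  ultimately show ?thesis
    using bij_betw_same_card[OF bij_e] by simp
qed

lemma aff_dim_fiber: "aff_dim {x. real_matrix M *v x = b} = int d"
proof -
  have "{x. real_matrix M *v x = b} = (+) (param b (\<lambda>_. 0)) ` {x. real_matrix M *v x = 0}"
  proof (intro equalityI subsetI)
    fix x assume "x \<in> {x. real_matrix M *v x = b}"
    then show "x \<in> (+) (param b (\<lambda>_. 0)) ` {x. real_matrix M *v x = 0}"
      by (intro image_eqI[of _ _ "x - param b (\<lambda>_. 0)"]) (auto simp: matrix_vector_mult_diff_distrib)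
  qed (auto simp: matrix_vector_right_distrib)
  moreover have "subspace {x. real_matrix M *v x = 0}"
    by (rule linear_subspace_kernel) simp
  ultimately show ?thesis
    by (simp add: aff_dim_translation_eq aff_dim_subspace dim_kernel)
qed

text \<open>The hull lies in the affine space of all solutions, and both have dimension d.\<close>

lemma affine_hull_fiber_polytope:
  assumes "aff_dim (fiber_polytope M b) = int d"
  shows "affine hull fiber_polytope M b = {x. real_matrix M *v x = b}"
proof (rule affine_dim_equal)
  show "affine {x. real_matrix M *v x = b}"
    unfolding affine_def by (auto simp: matrix_vector_right_distrib matrix_vector_mult_scaleR simp flip: scaleR_left_distrib)
  then show "affine hull fiber_polytope M b \<subseteq> {x. real_matrix M *v x = b}"
    by (intro hull_minimal) (auto simp: fiber_polytope_def)
  show "affine hull fiber_polytope M b \<noteq> {}"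
    using assms aff_dim_empty[of "fiber_polytope M b"] by auto
qed (simp_all add: assms aff_dim_fiber)

text \<open>The kernel of \<open>M\<close> consists of the vectors U (0, w). Here w is read off from
  a vector of R^n, which makes the parametrisation a linear map between Euclidean spaces.\<close>

definition kernel_point :: "real^'n \<Rightarrow> real^'n" where
  "kernel_point v = real_matrix U *v join 0 (tail v)"

lemma linear_kernel_point: "linear kernel_point"
proof (rule linearI)
  fix x y :: "real^'n" and c :: real
  have "join 0 (tail (x + y)) = join 0 (tail x) + join 0 (tail y)"
    by (simp add: vec_eq_split tail_def)
  then show "kernel_point (x + y) = kernel_point x + kernel_point y"
    by (simp add: kernel_point_def matrix_vector_right_distrib)
  have "join 0 (tail (c *\<^sub>R x)) = c *\<^sub>R join 0 (tail x)"
    by (simp add: vec_eq_split tail_def)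
  then show "kernel_point (c *\<^sub>R x) = c *\<^sub>R kernel_point x"
    by (simp add: kernel_point_def matrix_vector_mult_scaleR)
qed

lemma M_kernel_point [simp]: "real_matrix M *v kernel_point v = 0"
  by (simp add: kernel_iff kernel_point_def)

lemma kernel_point_V: "real_matrix M *v x = 0 \<Longrightarrow> kernel_point (real_matrix V *v x) = x"
  unfolding kernel_iff kernel_point_def
  by (subst (2) U_V[symmetric], intro arg_cong[of _ _ "(*v) _"]) (simp add: vec_eq_split tail_def)

text \<open>Both \<open>U\<close> and its inverse \<open>V\<close> preserve integrality, so w gives
  lattice coordinates on the integer kernel of \<open>M\<close>.\<close>

lemma kernel_point_integer_iff:
  "kernel_point v \<in> integer_points \<longleftrightarrow> (\<forall>k<d. v $ e k \<in> \<int>)"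
proof -
  have "join 0 (tail v) \<in> integer_points \<longleftrightarrow> (\<forall>k<d. v $ e k \<in> \<int>)"
  proof
    assume "join 0 (tail v) \<in> integer_points"
    then have *: "join 0 (tail v) $ e k \<in> \<int>" for k
      by (simp add: integer_points_def)
    show "\<forall>k<d. v $ e k \<in> \<int>"
    proof (intro allI impI)
      fix k assume "k < d"
      then show "v $ e k \<in> \<int>"
        using *[of k] by (simp add: tail_def)
    qed
  next
    assume *: "\<forall>k<d. v $ e k \<in> \<int>"
    have "join 0 (tail v) $ i \<in> \<int>" for i
      by (cases i rule: coordinate_cases) (use * in \<open>auto simp: tail_def\<close>)
    then show "join 0 (tail v) \<in> integer_points"
      by (simp add: integer_points_def)
  qed
  moreover have "kernel_point v \<in> integer_points \<longleftrightarrow> join 0 (tail v) \<in> integer_points"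
    using integer_points_matrix_mult[of "kernel_point v" V] integer_points_matrix_mult[of "join 0 (tail v)" U]
    by (auto simp: kernel_point_def)
  ultimately show ?thesis by simp
qed

text \<open>The chart records the w-part of V (x - p); its inverse sends w to p + U (0, w).\<close>

lemma lattice_chart_exists:
  assumes dim: "aff_dim (fiber_polytope M b) = int d"
  shows "\<exists>\<Phi>. lattice_chart (fiber_polytope M b) \<Phi>"
proof -
  let ?A = "{x. real_matrix M *v x = b}"
  have d: "polytope_dim (fiber_polytope M b) = d"
    by (simp add: polytope_dim_def dim)
  \<comment> \<open>An integer solution is taken when there is one; otherwise any solution serves as
    base point.\<close>
  obtain p where p: "real_matrix M *v p = b" "?A \<inter> integer_points \<noteq> {} \<Longrightarrow> p \<in> integer_points"
  proof (cases "?A \<inter> integer_points = {}")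
    case True
    then show thesis using that[of "param b (\<lambda>_. 0)"] by simp
  next
    case False
    then obtain p where "p \<in> ?A" "p \<in> integer_points" by blast
    then show thesis using that[of p] by simp
  qed
  define \<Phi> where "\<Phi> x = tail (real_matrix V *v (x - p))" for x
  define \<Psi> where "\<Psi> w = p + real_matrix U *v join 0 w" for w
  have \<Psi>A: "real_matrix M *v \<Psi> w = b" for w
    by (simp add: \<Psi>_def matrix_vector_right_distrib M_U p(1) zero_vec_def[symmetric])
  have \<Psi>\<Phi>: "\<Psi> (\<Phi> x) = x" if "real_matrix M *v x = b" for x
    using kernel_point_V[of "x - p"] that p(1)
    by (simp add: \<Psi>_def \<Phi>_def kernel_point_def matrix_vector_mult_diff_distrib)
  have \<Phi>\<Psi>: "\<Phi> (\<Psi> w) = w" if "w \<in> {..<d} \<rightarrow>\<^sub>E UNIV" for w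
    using that by (simp add: \<Psi>_def \<Phi>_def tail_join space_PiM)
  have \<Phi>_PiE: "\<Phi> x \<in> {..<d} \<rightarrow>\<^sub>E UNIV" for x
    using tail_in_space by (simp add: \<Phi>_def space_PiM)
  have integer: "x - p \<in> integer_points \<longleftrightarrow> \<Phi> x \<in> {..<d} \<rightarrow>\<^sub>E \<int>" if "real_matrix M *v x = b" for x
    using kernel_point_V[of "x - p"] kernel_point_integer_iff[of "real_matrix V *v (x - p)"] that p(1)
    by (auto simp: matrix_vector_mult_diff_distrib \<Phi>_def tail_def PiE_iff)
  have "lattice_chart (fiber_polytope M b) \<Phi>"
    unfolding lattice_chart_def affine_hull_fiber_polytope[OF dim] d
  proof (intro conjI ballI allI impI bexI[of _ p])
    show "bij_betw \<Phi> ?A ({..<d} \<rightarrow>\<^sub>E UNIV)"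
      by (rule bij_betw_byWitness[of _ \<Psi>]) (use \<Psi>\<Phi> \<Phi>\<Psi> \<Phi>_PiE \<Psi>A in auto)
  next
    fix x y t k assume "k < d"
    have "(1 - t) *\<^sub>R x + t *\<^sub>R y - p = (1 - t) *\<^sub>R (x - p) + t *\<^sub>R (y - p)"
      by (simp add: algebra_simps)
    then show "\<Phi> ((1 - t) *\<^sub>R x + t *\<^sub>R y) k = (1 - t) * \<Phi> x k + t * \<Phi> y k"
      using \<open>k < d\<close> by (simp add: \<Phi>_def tail_def matrix_vector_right_distrib matrix_vector_mult_scaleR)
  next
    show "\<Phi> ` {x \<in> ?A. x - p \<in> integer_points} = {..<d} \<rightarrow>\<^sub>E \<int>"
    proof (intro equalityI subsetI)
      fix w assume w: "w \<in> {..<d} \<rightarrow>\<^sub>E (\<int> :: real set)"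
      then have "\<Phi> (\<Psi> w) = w"
        by (intro \<Phi>\<Psi>) auto
      then show "w \<in> \<Phi> ` {x \<in> ?A. x - p \<in> integer_points}"
        using w integer[OF \<Psi>A, of w] \<Psi>A[of w] by (intro image_eqI[of _ _ "\<Psi> w"]) auto
    qed (use integer in auto)
  qed (use p in auto)
  then show ?thesis by blast
qed

text \<open>An arbitrary chart differs from the parametrisation of the fiber by an affine map whose linear
  part is an automorphism of the integer lattice. Extending that linear part by the identity on the
  remaining coordinates makes it a map of a Euclidean space, where determinants are available.\<close>

lemma measure_lattice_chart:
  assumes dim: "aff_dim (fiber_polytope M b) = int d" and chart: "lattice_chart (fiber_polytope M b) \<Phi>"
  shows "measure (lborel_fun d) (\<Phi> ` fiber_polytope M b) = measure (lborel_fun d) (slice b)"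
proof -
  let ?A = "{x. real_matrix M *v x = b}"
  have d: "polytope_dim (fiber_polytope M b) = d"
    by (simp add: polytope_dim_def dim)
  have bij: "bij_betw \<Phi> ?A ({..<d} \<rightarrow>\<^sub>E UNIV)"
    and aff': "\<forall>x\<in>?A. \<forall>y\<in>?A. \<forall>t. \<forall>k<d.
        \<Phi> ((1 - t) *\<^sub>R x + t *\<^sub>R y) k = (1 - t) * \<Phi> x k + t * \<Phi> y k"
    and base: "\<exists>p\<in>?A. (?A \<inter> integer_points \<noteq> {} \<longrightarrow> p \<in> integer_points) \<and>
        \<Phi> ` {x \<in> ?A. x - p \<in> integer_points} = {..<d} \<rightarrow>\<^sub>E \<int>"
    using chart unfolding lattice_chart_def affine_hull_fiber_polytope[OF dim] d by simp_all
  have aff: "\<Phi> ((1 - t) *\<^sub>R x + t *\<^sub>R y) k = (1 - t) * \<Phi> x k + t * \<Phi> y k"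
    if "x \<in> ?A" "y \<in> ?A" "k < d" for x y t k
    using aff'[rule_format, OF that] .
  obtain p where p: "p \<in> ?A" and lattice: "\<Phi> ` {x \<in> ?A. x - p \<in> integer_points} = {..<d} \<rightarrow>\<^sub>E \<int>"
    using base by (elim bexE conjE)
  have inj: "\<Phi> x = \<Phi> y \<Longrightarrow> x \<in> ?A \<Longrightarrow> y \<in> ?A \<Longrightarrow> x = y" for x y
    using bij by (auto simp: bij_betw_def inj_on_def)
  have \<Phi>_ext: "\<Phi> x = \<Phi> y \<longleftrightarrow> (\<forall>k<d. \<Phi> x k = \<Phi> y k)" if "x \<in> ?A" "y \<in> ?A" for x y
    using PiE_ext[of "\<Phi> x" "{..<d}" "\<lambda>_. UNIV" "\<Phi> y"] bij_betwE[OF bij] that by auto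
  have \<Phi>_int: "\<Phi> x \<in> {..<d} \<rightarrow>\<^sub>E \<int> \<longleftrightarrow> x - p \<in> integer_points" if "x \<in> ?A" for x
  proof
    assume "\<Phi> x \<in> {..<d} \<rightarrow>\<^sub>E \<int>"
    then obtain y where y: "\<Phi> x = \<Phi> y" "y \<in> {x \<in> ?A. x - p \<in> integer_points}"
      unfolding lattice[symmetric] by (rule imageE)
    then show "x - p \<in> integer_points"
      using inj[OF y(1) that] by simp
  next
    assume "x - p \<in> integer_points"
    then show "\<Phi> x \<in> {..<d} \<rightarrow>\<^sub>E \<int>"
      unfolding lattice[symmetric] using that by (intro imageI) simp
  qed
  have pA: "p + kernel_point v \<in> ?A" for v
    using p by (simp add: matrix_vector_right_distrib)
  \<comment> \<open>The linear part of the chart, in kernel coordinates relative to the base point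
    p.\<close>
  define L where "L v k = \<Phi> (p + kernel_point v) k - \<Phi> p k" for v k
  have L_scale: "L (c *\<^sub>R v) k = c * L v k" if "k < d" for c v k
  proof -
    have "p + kernel_point (c *\<^sub>R v) = (1 - c) *\<^sub>R p + c *\<^sub>R (p + kernel_point v)"
      by (simp add: linear_scale[OF linear_kernel_point] algebra_simps)
    then show ?thesis
      using aff[OF p pA that, of c v] by (simp add: L_def algebra_simps)
  qed
  have L_add: "L (v + v') k = L v k + L v' k" if "k < d" for v v' k
  proof -
    \<comment> \<open>The chart is affine on pairs of points only, so additivity comes from
      midpoints and is then rescaled by \<open>L_scale\<close>.\<close>
    have "p + kernel_point ((1/2) *\<^sub>R (v + v')) = (1 - 1/2) *\<^sub>R (p + kernel_point v) + (1/2) *\<^sub>R (p + kernel_point v')"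
    proof -
      have "p = (1/2) *\<^sub>R p + (1/2) *\<^sub>R p"
        by (simp flip: scaleR_left_distrib)
      then show ?thesis
        by (simp add: linear_scale[OF linear_kernel_point] linear_add[OF linear_kernel_point] scaleR_add_right)
    qed
    then have "L ((1/2) *\<^sub>R (v + v')) k = (L v k + L v' k) / 2"
      using aff[OF pA pA that, of "1/2" v v'] by (simp add: L_def field_simps)
    then show ?thesis
      unfolding L_scale[OF that] by simp
  qed
  \<comment> \<open>The extension of \<open>L\<close> by the identity on the
    \<open>f\<close>-coordinates, an endomorphism of R^n.\<close>
  define g where "g v = join (\<chi> t. v $ f t) (L v)" for v
  have lin: "linear g"
    by (rule linearI) (simp_all add: g_def vec_eq_split L_add L_scale)
  have g_f: "g v $ f t = v $ f t" and g_e: "k < d \<Longrightarrow> g v $ e k = L v k" for v t k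
    by (simp_all add: g_def)
  have kp_cong: "kernel_point v = kernel_point v' \<longleftrightarrow> (\<forall>k<d. v $ e k = v' $ e k)" for v v'
  proof
    assume "kernel_point v = kernel_point v'"
    then have "join 0 (tail v) = join 0 (tail v')"
      unfolding kernel_point_def by (metis V_U)
    then show "\<forall>k<d. v $ e k = v' $ e k"
      by (simp add: vec_eq_split tail_def)
  next
    assume "\<forall>k<d. v $ e k = v' $ e k"
    then have "tail v = tail v'" by (auto simp: tail_def)
    then show "kernel_point v = kernel_point v'" by (simp add: kernel_point_def)
  qed
  have "inj g"
  proof (rule injI)
    fix v v' assume eq: "g v = g v'"
    have "\<Phi> (p + kernel_point v) k = \<Phi> (p + kernel_point v') k" if "k < d" for k
      using g_e[OF that, of v] g_e[OF that, of v'] eq by (simp add: L_def)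
    then have "p + kernel_point v = p + kernel_point v'"
      using \<Phi>_ext[OF pA pA] inj[OF _ pA pA] by blast
    then have "\<forall>k<d. v $ e k = v' $ e k"
      by (simp only: add_left_cancel kp_cong)
    moreover have "v $ f t = v' $ f t" for t
      using g_f eq by metis
    ultimately show "v = v'"
      by (simp add: vec_eq_split)
  qed
  then have bij_g: "bij g"
    using linear_injective_imp_surjective[OF lin] by (simp add: bij_def)
  have integer_split: "v \<in> integer_points \<longleftrightarrow> (\<forall>t. v $ f t \<in> \<int>) \<and> (\<forall>k<d. v $ e k \<in> \<int>)" for v
  proof
    assume *: "(\<forall>t. v $ f t \<in> \<int>) \<and> (\<forall>k<d. v $ e k \<in> \<int>)"
    have "v $ i \<in> \<int>" for i
      by (cases i rule: coordinate_cases) (use * in auto)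
    then show "v \<in> integer_points" by (simp add: integer_points_def)
  qed (simp add: integer_points_def)
  \<comment> \<open>Because p - p = 0 is an integer point, p itself goes to Z^d, so passing between
    the chart and its linear part preserves integrality.\<close>
  have \<Phi>p: "\<Phi> p k \<in> \<int>" if "k < d" for k
    using \<Phi>_int[OF p] that by (auto simp: integer_points_def)
  have "(\<forall>k<d. L v k \<in> \<int>) \<longleftrightarrow> (\<forall>k<d. v $ e k \<in> \<int>)" for v
  proof -
    have "L v k \<in> \<int> \<longleftrightarrow> \<Phi> (p + kernel_point v) k \<in> \<int>" if "k < d" for k
    proof
      assume "L v k \<in> \<int>"
      then have "L v k + \<Phi> p k \<in> \<int>" using \<Phi>p[OF that] by (rule Ints_add)
      then show "\<Phi> (p + kernel_point v) k \<in> \<int>" by (simp add: L_def)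
    qed (simp add: L_def \<Phi>p[OF that])
    then have "(\<forall>k<d. L v k \<in> \<int>) \<longleftrightarrow> \<Phi> (p + kernel_point v) \<in> {..<d} \<rightarrow>\<^sub>E \<int>"
      using bij_betwE[OF bij] pA by (auto simp: PiE_iff)
    also have "\<dots> \<longleftrightarrow> kernel_point v \<in> integer_points"
      using \<Phi>_int[OF pA] by simp
    finally show ?thesis
      by (simp add: kernel_point_integer_iff)
  qed
  then have int: "g v \<in> integer_points \<longleftrightarrow> v \<in> integer_points" for v
    by (simp add: integer_split g_f g_e)
  have det: "\<bar>det (matrix g)\<bar> = 1"
    by (rule det_lattice_automorphism[OF lin bij_g int])
  \<comment> \<open>\<open>c\<close> holds the kernel coordinates of p and \<open>c'\<close> its
    chart coordinates. With these shifts the affine map \<open>a\<close> fixes y and sends w to the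
    chart coordinates of \<open>param b w\<close>.\<close>
  define c where "c = join 0 (tail (real_matrix V *v p))"
  define c' where "c' = join (0 :: real^'s) (\<Phi> p)"
  define a where "a v = g (v - c) + c'" for v
  define \<Psi> where "\<Psi> w = \<Phi> (param b w)" for w
  have \<Psi>W: "\<Psi> w \<in> space (lborel_fun d)" for w
    using bij_betwE[OF bij] by (simp add: \<Psi>_def space_PiM)
  have \<Psi>_inj: "w = w'" if "\<Psi> w = \<Psi> w'" "w \<in> space (lborel_fun d)" "w' \<in> space (lborel_fun d)" for w w'
  proof -
    have "param b w = param b w'"
      using that(1) by (intro inj) (simp_all add: \<Psi>_def)
    then have "tail (real_matrix V *v param b w) = tail (real_matrix V *v param b w')" by simp
    then show ?thesis using that(2,3) by (simp add: tail_param)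
  qed
  have a_join: "a (join y w) = join y (\<Psi> w)" for y w
  proof -
    have "kernel_point (join y w - c) = param b w - p"
    proof -
      have "param b w - p = kernel_point (real_matrix V *v (param b w - p))"
        using p by (intro kernel_point_V[symmetric]) (simp add: matrix_vector_mult_diff_distrib)
      also have "\<dots> = kernel_point (join y w - c)"
        unfolding kp_cong by (simp add: c_def param_def matrix_vector_mult_diff_distrib tail_def)
      finally show ?thesis by simp
    qed
    then have "L (join y w - c) k = \<Psi> w k - \<Phi> p k" for k
      by (simp add: L_def \<Psi>_def)
    moreover have "c $ f t = 0" for t
      by (simp add: c_def)
    ultimately show ?thesis
      by (simp add: a_def g_def c'_def vec_eq_split)
  qed
  \<comment> \<open>The cylinder over S with the unit cube as base: its n-dimensional volume is the
    d-dimensional volume of S, so invariance under \<open>a\<close> descends to S.\<close>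
  define E where "E S = {v. (\<chi> t. v $ f t) \<in> cbox (0 :: real^'s) 1 \<and> tail v \<in> S}" for S
  have meas_tail: "tail \<in> borel \<rightarrow>\<^sub>M lborel_fun d"
    unfolding tail_def[abs_def] by (intro measurable_restrict) simp
  have sets_E: "E S \<in> sets borel" if "S \<in> sets (lborel_fun d)" for S
  proof -
    have "closed {v :: real^'n. (\<chi> t. v $ f t) \<in> cbox (0 :: real^'s) 1}"
      by (auto simp: mem_box_cart intro!: closed_Collect_all closed_Collect_conj closed_Collect_le continuous_intros)
    moreover have "{v. tail v \<in> S} \<in> sets borel"
      using measurable_sets[OF meas_tail that] by (simp add: vimage_def)
    moreover have "E S = {v. (\<chi> t. v $ f t) \<in> cbox (0 :: real^'s) 1} \<inter> {v. tail v \<in> S}"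
      by (auto simp: E_def)
    ultimately show ?thesis by simp
  qed
  have emeasure_E: "emeasure lborel (E S) = emeasure (lborel_fun d) S" if S: "S \<in> sets (lborel_fun d)" for S
  proof -
    have sub: "S \<subseteq> space (lborel_fun d)" using S by (rule sets.sets_into_space)
    have "(\<lambda>(y, w). join y w) -` E S \<inter> space (lborel \<Otimes>\<^sub>M lborel_fun d) = cbox (0 :: real^'s) 1 \<times> S"
      using sub by (auto simp: E_def space_pair_measure tail_join vec_lambda_eta)
    moreover have "emeasure lborel (E S) = emeasure (distr (lborel \<Otimes>\<^sub>M lborel_fun d) borel (\<lambda>(y, w). join y w)) (E S)"
      by (simp only: lborel_join)
    ultimately have "emeasure lborel (E S) = emeasure (lborel \<Otimes>\<^sub>M lborel_fun d) (cbox (0 :: real^'s) 1 \<times> S)"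
      using sets_E[OF S] by (simp add: emeasure_distr)
    also have "\<dots> = emeasure lborel (cbox (0 :: real^'s) 1) * emeasure (lborel_fun d) S"
      using S by (intro lborel_fun_sigma.emeasure_pair_measure_Times) auto
    also have "emeasure lborel (cbox (0 :: real^'s) 1) = 1"
    proof -
      have "(1 :: real^'s) \<bullet> b = 1" if "b \<in> Basis" for b
        using that by (auto simp: Basis_vec_def inner_axis)
      then show ?thesis by (simp add: emeasure_lborel_cbox_eq)
    qed
    finally show ?thesis by simp
  qed
  let ?S = "slice b" and ?S' = "\<Psi> ` slice b"
  have pre: "a -` E ?S' = E ?S"
  proof (intro set_eqI)
    fix v
    obtain y w where v: "v = join y w" "w \<in> space (lborel_fun d)"
      by (metis join_tail tail_in_space)
    have "w \<in> slice b \<longleftrightarrow> \<Psi> w \<in> \<Psi> ` slice b"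
      using \<Psi>_inj v(2) by (auto simp: slice_def)
    then show "v \<in> a -` E ?S' \<longleftrightarrow> v \<in> E ?S"
      using v \<Psi>W by (simp add: a_join E_def tail_join)
  qed
  \<comment> \<open>The image is measurable because it is also a preimage, under the inverse of
    \<open>a\<close> restricted to y = 0; the point y = 0 belongs to the unit cube.\<close>
  have sets_S': "?S' \<in> sets (lborel_fun d)"
  proof -
    have "linear (inv g)"
      using lin \<open>inj g\<close> by (simp add: inj_linear_imp_inv_linear)
    then have [measurable]: "inv g \<in> borel_measurable borel"
      by (simp add: borel_measurable_continuous_onI linear_continuous_on linear_conv_bounded_linear)
    have [measurable]: "(\<lambda>w. join 0 w) \<in> borel_measurable (lborel_fun d)"
      using measurable_Pair2[OF measurable_join, of 0] by simp
    have meas: "(\<lambda>w. inv g (join 0 w - c') + c) \<in> borel_measurable (lborel_fun d)"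
      by measurable
    have "?S' = (\<lambda>w. inv g (join 0 w - c') + c) -` E ?S \<inter> space (lborel_fun d)"
    proof (intro set_eqI)
      fix w
      show "w \<in> ?S' \<longleftrightarrow> w \<in> (\<lambda>w. inv g (join 0 w - c') + c) -` E ?S \<inter> space (lborel_fun d)"
      proof (cases "w \<in> space (lborel_fun d)")
        case True
        have "a (inv g (join 0 w - c') + c) = join 0 w"
          using bij_g by (simp add: a_def bij_is_surj surj_f_inv_f)
        then have "inv g (join 0 w - c') + c \<in> E ?S \<longleftrightarrow> join 0 w \<in> E ?S'"
          unfolding pre[symmetric] by simp
        also have "\<dots> \<longleftrightarrow> w \<in> ?S'"
          using True by (simp add: E_def tail_join mem_box_cart)
        finally show ?thesis using True by simp
      qed (use \<Psi>W in auto)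
    qed
    then show ?thesis
      using measurable_sets[OF meas sets_E[OF sets_slice]] by simp
  qed
  have "emeasure (lborel_fun d) ?S = emeasure lborel (a -` E ?S')"
    by (simp add: pre emeasure_E)
  also have "\<dots> = emeasure lborel (E ?S')"
    unfolding a_def[abs_def] by (rule emeasure_lborel_affine_vimage[OF lin det sets_E[OF sets_S']])
  also have "\<dots> = emeasure (lborel_fun d) ?S'"
    by (rule emeasure_E[OF sets_S'])
  finally have "measure (lborel_fun d) ?S' = measure (lborel_fun d) ?S"
    by (simp add: measure_def)
  moreover have "\<Phi> ` fiber_polytope M b = ?S'"
    by (simp add: fiber_polytope_eq image_image \<Psi>_def)
  ultimately show ?thesis by simp
qed

text \<open>The chart selected by \<open>SOME\<close> is unspecified, so the volume is needed for
  every chart. The factor |det H| cancels the denominator in \<open>fiber_power\<close>.\<close>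

lemma relative_volume_fiber_polytope:
  assumes "aff_dim (fiber_polytope M b) = int d"
  shows "relative_volume (fiber_polytope M b) = \<bar>real_of_int (det H)\<bar> * truncated_power M b"
proof -
  have "lattice_chart (fiber_polytope M b) (SOME \<Phi>. lattice_chart (fiber_polytope M b) \<Phi>)"
    using lattice_chart_exists[OF assms] by (rule someI_ex)
  then have "relative_volume (fiber_polytope M b) = measure (lborel_fun d) (slice b)"
    using measure_lattice_chart[OF assms] by (simp add: relative_volume_def polytope_dim_def assms)
  then show ?thesis
    using det_H by (simp add: truncated_power_eq fiber_power_def)
qed

end

text \<open>A nonzero kernel vector of the orthant would be a direction in which the fiber extends
  to infinity.\<close>

lemma pointed_of_bounded_fiber:
  fixes M :: "int^'n^'s"
  assumes "bounded (fiber_polytope M b)" "fiber_polytope M b \<noteq> {}"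
    and u: "u \<in> nonneg_orthant" "real_matrix M *v u = 0"
  shows "u = 0"
proof (rule ccontr)
  assume "u \<noteq> 0"
  obtain x where x: "x \<in> fiber_polytope M b" using assms(2) by blast
  obtain B where B: "\<And>y. y \<in> fiber_polytope M b \<Longrightarrow> norm y \<le> B"
    using assms(1) unfolding bounded_iff by blast
  \<comment> \<open>Chosen so that |t u| = |B| + |x| + 1, which puts x + t u outside the ball of
    radius B.\<close>
  define t where "t = (\<bar>B\<bar> + norm x + 1) / norm u"
  have t: "t \<ge> 0" by (simp add: t_def)
  have "x + t *\<^sub>R u \<in> fiber_polytope M b"
    using x u t by (auto simp: fiber_polytope_def nonneg_orthant_def matrix_vector_right_distrib matrix_vector_mult_scaleR)
  then have "norm (x + t *\<^sub>R u) \<le> B" by (rule B)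
  moreover have "norm (t *\<^sub>R u) = \<bar>B\<bar> + norm x + 1"
    using \<open>u \<noteq> 0\<close> by (simp add: t_def)
  moreover have "norm (t *\<^sub>R u) \<le> norm (x + t *\<^sub>R u) + norm x"
    using norm_triangle_ineq4[of "x + t *\<^sub>R u" x] by simp
  ultimately show False by linarith
qed

theorem theorem7p1:
  fixes M :: "int^'n^'s" and b :: "real^'s"
  assumes "rank (real_matrix M) = CARD('s)"
    and "rational_polytope (fiber_polytope M b)"
    and "aff_dim (fiber_polytope M b) = int CARD('n) - int CARD('s)"
  shows "relative_volume (fiber_polytope M b) =
           real_of_int (GCD Y\<in>square_bases M. \<bar>det Y\<bar>) * truncated_power M b"
proof -
  obtain U V :: "int^'n^'n" and f :: "'s \<Rightarrow> 'n" where UV: "U ** V = mat 1" "V ** U = mat 1" and inj: "inj f"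
    and zero: "\<And>i j. j \<notin> range f \<Longrightarrow> (M ** U) $ i $ j = 0" and det: "det (\<chi> i j. (M ** U) $ i $ f j) \<noteq> 0"
    using full_rank_column_reduction[OF assms(1)] by metis
  define d where "d = card (- range f)"
  obtain e where e: "bij_betw e {..<d} (- range f)"
    using finite_same_card_bij[of "{..<d}" "- range f"] by (auto simp: d_def)
  have bounded: "bounded (fiber_polytope M b)"
    using assms(2) by (auto simp: rational_polytope_def finite_imp_bounded_convex_hull)
  \<comment> \<open>As s is at most n, the dimension is not -1, the value that
    \<open>aff_dim\<close> takes on the empty set.\<close>
  have "CARD('s) \<le> CARD('n)"
    using rank_bound[of "real_matrix M"] assms(1) by simp
  then have ne: "fiber_polytope M b \<noteq> {}"
    using assms(3) by (auto simp: aff_dim_empty)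
  interpret column_reduced f d e M U V "\<chi> i j. (M ** U) $ i $ f j"
    by unfold_locales (use UV inj e zero det pointed_of_bounded_fiber[OF bounded ne] in auto)
  have "aff_dim (fiber_polytope M b) = int d"
    using assms(3) CARD_eq by simp
  from relative_volume_fiber_polytope[OF this] show ?thesis
    by (simp add: Gcd_square_bases[OF UV(1) inj zero refl])
qed

end
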